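(* Let $k$ be a field, $H$ a Hopf algebra over $k$, and $A$ a right $H$-comodule algebra over $k$ with $B=A^{co\,H}$. Then every generalised quotient $Q\in\mathrm{Quot}_{gen}(H)$ which is closed in the Galois connection between $\mathrm{Sub}_{Alg}(A/B)$ and $\mathrm{Quot}_{gen}(H)$ is of the form $H/K^+H$ for some $K\in\mathrm{Sub}_{gen}(H)$. Thus $Q\in\mathrm{Quot}_{gen}(H)$ cannot be closed in this Galois connection if $Q$ is not closed in the Galois connection between $\mathrm{Sub}_{gen}(H)$ and $\mathrm{Quot}_{gen}(H)$, i.e. when the map $\mathrm{can}_Q:H\otimes_{H^{co\,Q}}H\to H\otimes Q$, $h\otimes h'\mapsto hh'_{(1)}\otimes\pi(h'_{(2)})$ (with $\pi:H\to Q$ the projection), is not bijective.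
   Context: A right $H$-comodule algebra is an algebra $A$ with a counital coassociative coaction $\delta_A:A\to A\otimes H$, $a\mapsto a_{(0)}\otimes a_{(1)}$, that is an algebra homomorphism; $A^{co\,H}=\{a:\delta_A(a)=a\otimes1_H\}$. $\mathrm{Sub}_{Alg}(A/B)$ is the poset (under inclusion) of subalgebras $S$ with $B\subseteq S\subseteq A$. $\mathrm{Sub}_{gen}(H)$ is the poset (under inclusion) of left coideal subalgebras of $H$ (unital subalgebras $K$ with $\Delta(K)\subseteq H\otimes K$); $K^+=K\cap\ker\epsilon$. $\mathrm{Quot}_{gen}(H)$ is the complete lattice of quotients $H/I$ by right ideal coideals $I$, ordered by $H/I\succcurlyeq H/J\Leftrightarrow I\subseteq J$. For $Q$ in it with projection $\pi$, $A^{co\,Q}=\{a\in A:a_{(0)}\otimes\pi(a_{(1)})=a\otimes\pi(1_H)\}$ and $H^{co\,Q}=\{h\in H:h_{(1)}\otimes\pi(h_{(2)})=h\otimes\pi(1_H)\}$. The Galois connection between $\mathrm{Sub}_{Alg}(A/B)$ and $\mathrm{Quot}_{gen}(H)$ is given by $\phi(Q)=A^{co\,Q}$ and $\psi(S)=\bigvee\{Q:S\subseteq A^{co\,Q}\}$; $Q$ is closed in it if $\psi\phi(Q)=Q$. The Galois connection between $\mathrm{Sub}_{gen}(H)$ and $\mathrm{Quot}_{gen}(H)$ is given by $Q\mapsto H^{co\,Q}$ and $K\mapsto H/K^+H$; $Q$ is closed in it if $Q=H/(H^{co\,Q})^+H$. *)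

theory Defs
  imports Complex_Main "HOL-Library.Poly_Mapping" "HOL-Algebra.Lattice"
begin

section \<open>Modules with explicit carrier and balanced tensor products\<close>

text \<open>
  The spaces \<open>H\<close> and \<open>A\<close> are types, but the quotients \<open>H/I\<close> and the tensor products depend on
  parameters, so they are sets of cosets. The following record covers all three.
  The component \<open>mact\<close> is an action of scalars from either side; over a field the side is immaterial.
\<close>

record ('r, 'm) kmod =
  elems :: "'m set"
  madd :: "'m \<Rightarrow> 'm \<Rightarrow> 'm"
  mact :: "'r \<Rightarrow> 'm \<Rightarrow> 'm"

definition vs :: "('k \<Rightarrow> 'm::plus \<Rightarrow> 'm) \<Rightarrow> ('k, 'm) kmod"
  where "vs s = \<lparr>elems = UNIV, madd = (+), mact = s\<rparr>"

definition rep :: "'x set \<Rightarrow> 'x"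
  where "rep X = (SOME x. x \<in> X)"

text \<open>
  \<open>M \<otimes>\<^sub>R N\<close>, for \<open>R\<close> acting on \<open>M\<close> from the right and on \<open>N\<close> from the left, is the free
  abelian group on \<open>elems M \<times> elems N\<close> modulo the subgroup generated by the usual relators.
\<close>

inductive_set tensor_rel ::
  "'r set \<Rightarrow> ('r, 'm) kmod \<Rightarrow> ('r, 'n) kmod \<Rightarrow> ('m \<times> 'n \<Rightarrow>\<^sub>0 int) set"
  for R :: "'r set" and M :: "('r, 'm) kmod" and N :: "('r, 'n) kmod"
  where
    zero: "0 \<in> tensor_rel R M N"
  | diff: "s \<in> tensor_rel R M N \<Longrightarrow> t \<in> tensor_rel R M N \<Longrightarrow> s - t \<in> tensor_rel R M N"
  | add_left: "m \<in> elems M \<Longrightarrow> m' \<in> elems M \<Longrightarrow> n \<in> elems N \<Longrightarrow>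
      frag_of (madd M m m', n) - frag_of (m, n) - frag_of (m', n) \<in> tensor_rel R M N"
  | add_right: "m \<in> elems M \<Longrightarrow> n \<in> elems N \<Longrightarrow> n' \<in> elems N \<Longrightarrow>
      frag_of (m, madd N n n') - frag_of (m, n) - frag_of (m, n') \<in> tensor_rel R M N"
  | balanced: "r \<in> R \<Longrightarrow> m \<in> elems M \<Longrightarrow> n \<in> elems N \<Longrightarrow>
      frag_of (mact M r m, n) - frag_of (m, mact N r n) \<in> tensor_rel R M N"

definition tensor_class ::
  "'r set \<Rightarrow> ('r, 'm) kmod \<Rightarrow> ('r, 'n) kmod \<Rightarrow> ('m \<times> 'n \<Rightarrow>\<^sub>0 int) \<Rightarrow> ('m \<times> 'n \<Rightarrow>\<^sub>0 int) set"
  where "tensor_class R M N t = (+) t ` tensor_rel R M N"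

text \<open>The set of all finite sums of elementary tensors \<open>m \<otimes> n\<close> with \<open>(m, n) \<in> P\<close>.\<close>

definition tensor_sums ::
  "'r set \<Rightarrow> ('r, 'm) kmod \<Rightarrow> ('r, 'n) kmod \<Rightarrow> ('m \<times> 'n) set \<Rightarrow> ('m \<times> 'n \<Rightarrow>\<^sub>0 int) set set"
  where "tensor_sums R M N P = tensor_class R M N ` {t. Poly_Mapping.keys t \<subseteq> P}"

definition tensor_carrier ::
  "'r set \<Rightarrow> ('r, 'm) kmod \<Rightarrow> ('r, 'n) kmod \<Rightarrow> ('m \<times> 'n \<Rightarrow>\<^sub>0 int) set set"
  where "tensor_carrier R M N = tensor_sums R M N (elems M \<times> elems N)"

text \<open>
  The additive map out of a tensor product into \<open>M \<otimes>\<^sub>R N\<close> that is determined by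
  \<open>x \<otimes> y \<mapsto> [b (x, y)]\<close>. It is independent of the representative whenever the assignment is
  biadditive and balanced, which is the case at every use below.
\<close>

definition tensor_lift ::
  "'r set \<Rightarrow> ('r, 'm) kmod \<Rightarrow> ('r, 'n) kmod \<Rightarrow> ('x \<times> 'y \<Rightarrow> ('m \<times> 'n \<Rightarrow>\<^sub>0 int)) \<Rightarrow>
   ('x \<times> 'y \<Rightarrow>\<^sub>0 int) set \<Rightarrow> ('m \<times> 'n \<Rightarrow>\<^sub>0 int) set"
  where "tensor_lift R M N b X = tensor_class R M N (frag_extend b (rep X))"

text \<open>The tensor product over the ground field, again as a module over it.\<close>

definition tensor ::
  "('k, 'm) kmod \<Rightarrow> ('k, 'n) kmod \<Rightarrow> ('k, ('m \<times> 'n \<Rightarrow>\<^sub>0 int) set) kmod"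
  where "tensor M N =
    \<lparr>elems = tensor_carrier UNIV M N,
     madd = (\<lambda>X Y. {s + t | s t. s \<in> X \<and> t \<in> Y}),
     mact = (\<lambda>c. tensor_lift UNIV M N (\<lambda>(m, n). frag_of (mact M c m, n)))\<rparr>"

definition pure_tensor ::
  "('k, 'm) kmod \<Rightarrow> ('k, 'n) kmod \<Rightarrow> 'm \<Rightarrow> 'n \<Rightarrow> ('m \<times> 'n \<Rightarrow>\<^sub>0 int) set"
  where "pure_tensor M N m n = tensor_class UNIV M N (frag_of (m, n))"

definition tensor_map ::
  "('k, 'm) kmod \<Rightarrow> ('k, 'n) kmod \<Rightarrow> ('x \<Rightarrow> 'm) \<Rightarrow> ('y \<Rightarrow> 'n) \<Rightarrow>
   ('x \<times> 'y \<Rightarrow>\<^sub>0 int) set \<Rightarrow> ('m \<times> 'n \<Rightarrow>\<^sub>0 int) set"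
  where "tensor_map M N f g = tensor_lift UNIV M N (\<lambda>(x, y). frag_of (f x, g y))"

text \<open>The linear map \<open>x \<otimes> y \<mapsto> f x y\<close> into a vector space with scalar multiplication \<open>s\<close>.\<close>

definition tensor_eval ::
  "('k::ring_1 \<Rightarrow> 'v::ab_group_add \<Rightarrow> 'v) \<Rightarrow> ('x \<Rightarrow> 'y \<Rightarrow> 'v) \<Rightarrow> ('x \<times> 'y \<Rightarrow>\<^sub>0 int) set \<Rightarrow> 'v"
  where "tensor_eval s f X =
    (\<Sum>(x, y)\<in>Poly_Mapping.keys (rep X). s (of_int (Poly_Mapping.lookup (rep X) (x, y))) (f x y))"

definition tensor_mult ::
  "('k, 'm::times) kmod \<Rightarrow> ('k, 'n::times) kmod \<Rightarrow>
   ('m \<times> 'n \<Rightarrow>\<^sub>0 int) set \<Rightarrow> ('m \<times> 'n \<Rightarrow>\<^sub>0 int) set \<Rightarrow> ('m \<times> 'n \<Rightarrow>\<^sub>0 int) set"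
  where "tensor_mult M N X Y = tensor_class UNIV M N
    (frag_extend (\<lambda>(x, y). frag_extend (\<lambda>(x', y'). frag_of (x * x', y * y')) (rep Y)) (rep X))"

definition linear_into :: "('k \<Rightarrow> 'v::plus \<Rightarrow> 'v) \<Rightarrow> ('k, 't) kmod \<Rightarrow> ('v \<Rightarrow> 't) \<Rightarrow> bool"
  where "linear_into s T f \<longleftrightarrow>
    (\<forall>x. f x \<in> elems T) \<and> (\<forall>x y. f (x + y) = madd T (f x) (f y)) \<and>
    (\<forall>c x. f (s c x) = mact T c (f x))"


section \<open>Algebras, Hopf algebras and comodule algebras\<close>

text \<open>The sort \<open>{ring, monoid_mult}\<close> (rather than \<open>ring_1\<close>) admits the zero algebra.\<close>

locale k_algebra = vector_space scale
  for scale :: "'k::field \<Rightarrow> 'a::{ring, monoid_mult} \<Rightarrow> 'a" +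
  assumes scale_mult_left: "scale c x * y = scale c (x * y)"
    and scale_mult_right: "x * scale c y = scale c (x * y)"

definition subalgebra :: "('k::field \<Rightarrow> 'a::{ring, monoid_mult} \<Rightarrow> 'a) \<Rightarrow> 'a set \<Rightarrow> bool"
  where "subalgebra scale S \<longleftrightarrow>
    module.subspace scale S \<and> 1 \<in> S \<and> (\<forall>x\<in>S. \<forall>y\<in>S. x * y \<in> S)"

text \<open>
  Coassociativity \<open>(\<rho> \<otimes> id) \<circ> \<rho> = (id \<otimes> \<Delta>) \<circ> \<rho>\<close> of \<open>\<rho> : M \<rightarrow> M \<otimes> H\<close>, as an equation in
  \<open>(M \<otimes> H) \<otimes> H\<close>: the right-hand side is transported along \<open>x \<otimes> (u \<otimes> v) \<mapsto> (x \<otimes> u) \<otimes> v\<close>.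
\<close>

definition coassociative ::
  "('k, 'm) kmod \<Rightarrow> ('k, 'h) kmod \<Rightarrow> ('h \<Rightarrow> ('h \<times> 'h \<Rightarrow>\<^sub>0 int) set) \<Rightarrow>
   ('m \<Rightarrow> ('m \<times> 'h \<Rightarrow>\<^sub>0 int) set) \<Rightarrow> bool"
  where "coassociative M H \<Delta> \<rho> \<longleftrightarrow>
    (\<forall>m. tensor_map (tensor M H) H \<rho> id (\<rho> m) =
         tensor_lift UNIV (tensor M H) H
           (\<lambda>(x, y). frag_extend (\<lambda>(u, v). frag_of (pure_tensor M H x u, v)) (rep (\<Delta> y)))
           (\<rho> m))"

locale hopf_algebra = k_algebra scaleH
  for scaleH :: "'k::field \<Rightarrow> 'h::{ring, monoid_mult} \<Rightarrow> 'h" +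
  fixes \<Delta> :: "'h \<Rightarrow> ('h \<times> 'h \<Rightarrow>\<^sub>0 int) set"
    and \<epsilon> :: "'h \<Rightarrow> 'k"
    and antipode :: "'h \<Rightarrow> 'h"
  assumes comult_linear: "linear_into scaleH (tensor (vs scaleH) (vs scaleH)) \<Delta>"
    and comult_coassoc: "coassociative (vs scaleH) (vs scaleH) \<Delta> \<Delta>"
    and counit_linear: "Vector_Spaces.linear scaleH (*) \<epsilon>"
    and counit_left: "tensor_eval scaleH (\<lambda>x y. scaleH (\<epsilon> x) y) (\<Delta> h) = h"
    and counit_right: "tensor_eval scaleH (\<lambda>x y. scaleH (\<epsilon> y) x) (\<Delta> h) = h"
    and comult_mult: "\<Delta> (g * h) = tensor_mult (vs scaleH) (vs scaleH) (\<Delta> g) (\<Delta> h)"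
    and comult_one: "\<Delta> 1 = pure_tensor (vs scaleH) (vs scaleH) 1 1"
    and counit_mult: "\<epsilon> (g * h) = \<epsilon> g * \<epsilon> h"
    and counit_one: "\<epsilon> 1 = 1"
    and antipode_linear: "Vector_Spaces.linear scaleH scaleH antipode"
    and antipode_left: "tensor_eval scaleH (\<lambda>x y. antipode x * y) (\<Delta> h) = scaleH (\<epsilon> h) 1"
    and antipode_right: "tensor_eval scaleH (\<lambda>x y. x * antipode y) (\<Delta> h) = scaleH (\<epsilon> h) 1"

locale comodule_algebra =
  hopf_algebra scaleH \<Delta> \<epsilon> antipode + A: k_algebra scaleA
  for scaleH :: "'k::field \<Rightarrow> 'h::{ring, monoid_mult} \<Rightarrow> 'h"
    and \<Delta> :: "'h \<Rightarrow> ('h \<times> 'h \<Rightarrow>\<^sub>0 int) set"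
    and \<epsilon> :: "'h \<Rightarrow> 'k"
    and antipode :: "'h \<Rightarrow> 'h"
    and scaleA :: "'k \<Rightarrow> 'a::{ring, monoid_mult} \<Rightarrow> 'a" +
  fixes \<delta> :: "'a \<Rightarrow> ('a \<times> 'h \<Rightarrow>\<^sub>0 int) set"
  assumes coaction_linear: "linear_into scaleA (tensor (vs scaleA) (vs scaleH)) \<delta>"
    and coaction_coassoc: "coassociative (vs scaleA) (vs scaleH) \<Delta> \<delta>"
    and coaction_counit: "tensor_eval scaleA (\<lambda>x y. scaleA (\<epsilon> y) x) (\<delta> a) = a"
    and coaction_mult: "\<delta> (a * b) = tensor_mult (vs scaleA) (vs scaleH) (\<delta> a) (\<delta> b)"
    and coaction_one: "\<delta> 1 = pure_tensor (vs scaleA) (vs scaleH) 1 1"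


section \<open>Generalised quotients and generalised subalgebras\<close>

definition right_ideal_coideal ::
  "('k::field \<Rightarrow> 'h::{ring, monoid_mult} \<Rightarrow> 'h) \<Rightarrow> ('h \<Rightarrow> ('h \<times> 'h \<Rightarrow>\<^sub>0 int) set) \<Rightarrow>
   ('h \<Rightarrow> 'k) \<Rightarrow> 'h set \<Rightarrow> bool"
  where "right_ideal_coideal scaleH \<Delta> \<epsilon> I \<longleftrightarrow>
    module.subspace scaleH I \<and> (\<forall>x\<in>I. \<forall>h. x * h \<in> I) \<and>
    (\<forall>x\<in>I. \<Delta> x \<in> tensor_sums UNIV (vs scaleH) (vs scaleH) (I \<times> UNIV \<union> UNIV \<times> I)) \<and>
    (\<forall>x\<in>I. \<epsilon> x = 0)"

text \<open>A quotient \<open>Q = H/I\<close> is represented by its set of cosets, from which \<open>I\<close> can be recovered.\<close>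

definition quot :: "'h::group_add set \<Rightarrow> 'h set set"
  where "quot I = UNIV // {(x, y). x - y \<in> I}"

definition proj :: "'h set set \<Rightarrow> 'h \<Rightarrow> 'h set"
  where "proj Q h = (THE X. X \<in> Q \<and> h \<in> X)"

definition quot_mod :: "('k \<Rightarrow> 'h::plus \<Rightarrow> 'h) \<Rightarrow> 'h set set \<Rightarrow> ('k, 'h set) kmod"
  where "quot_mod scaleH Q =
    \<lparr>elems = Q,
     madd = (\<lambda>X Y. {x + y | x y. x \<in> X \<and> y \<in> Y}),
     mact = (\<lambda>c X. proj Q (scaleH c (rep X)))\<rparr>"

text \<open>The poset of generalised quotients; \<open>x \<sqsubseteq> y\<close> in the record means \<open>y \<succcurlyeq> x\<close>.\<close>

definition Quot_gen ::
  "('k::field \<Rightarrow> 'h::{ring, monoid_mult} \<Rightarrow> 'h) \<Rightarrow> ('h \<Rightarrow> ('h \<times> 'h \<Rightarrow>\<^sub>0 int) set) \<Rightarrow>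
   ('h \<Rightarrow> 'k) \<Rightarrow> 'h set set gorder"
  where "Quot_gen scaleH \<Delta> \<epsilon> =
    \<lparr>carrier = {quot I | I. right_ideal_coideal scaleH \<Delta> \<epsilon> I},
     eq = (=),
     le = (\<lambda>P Q. \<exists>I J. right_ideal_coideal scaleH \<Delta> \<epsilon> I \<and> right_ideal_coideal scaleH \<Delta> \<epsilon> J \<and>
                  Q = quot I \<and> P = quot J \<and> I \<subseteq> J)\<rparr>"

definition Sub_gen ::
  "('k::field \<Rightarrow> 'h::{ring, monoid_mult} \<Rightarrow> 'h) \<Rightarrow> ('h \<Rightarrow> ('h \<times> 'h \<Rightarrow>\<^sub>0 int) set) \<Rightarrow> 'h set set"
  where "Sub_gen scaleH \<Delta> =
    {K. subalgebra scaleH K \<and>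
        (\<forall>x\<in>K. \<Delta> x \<in> tensor_sums UNIV (vs scaleH) (vs scaleH) (UNIV \<times> K))}"

definition plus_ideal ::
  "('k::field \<Rightarrow> 'h::{ring, monoid_mult} \<Rightarrow> 'h) \<Rightarrow> ('h \<Rightarrow> 'k) \<Rightarrow> 'h set \<Rightarrow> 'h set"
  where "plus_ideal scaleH \<epsilon> K = module.span scaleH {x * h | x h. x \<in> K \<and> \<epsilon> x = 0}"

text \<open>
  Coinvariants of \<open>\<rho> : M \<rightarrow> M \<otimes> H\<close> under \<open>Q\<close>; used with \<open>(A, \<delta>)\<close> for \<open>A\<^sup>c\<^sup>o\<^sup>Q\<close> and with
  \<open>(H, \<Delta>)\<close> for \<open>H\<^sup>c\<^sup>o\<^sup>Q\<close>.
\<close>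

definition coinvariants ::
  "('k \<Rightarrow> 'h::{plus, one} \<Rightarrow> 'h) \<Rightarrow> ('k \<Rightarrow> 'm::plus \<Rightarrow> 'm) \<Rightarrow>
   ('m \<Rightarrow> ('m \<times> 'h \<Rightarrow>\<^sub>0 int) set) \<Rightarrow> 'h set set \<Rightarrow> 'm set"
  where "coinvariants scaleH scaleM \<rho> Q =
    {m. tensor_map (vs scaleM) (quot_mod scaleH Q) id (proj Q) (\<rho> m) =
        pure_tensor (vs scaleM) (quot_mod scaleH Q) m (proj Q 1)}"

definition full_coinvariants ::
  "('k \<Rightarrow> 'h::{plus, one} \<Rightarrow> 'h) \<Rightarrow> ('k \<Rightarrow> 'm::plus \<Rightarrow> 'm) \<Rightarrow>
   ('m \<Rightarrow> ('m \<times> 'h \<Rightarrow>\<^sub>0 int) set) \<Rightarrow> 'm set"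
  where "full_coinvariants scaleH scaleM \<rho> =
    {m. \<rho> m = pure_tensor (vs scaleM) (vs scaleH) m 1}"


section \<open>The two Galois connections\<close>

definition Sub_Alg ::
  "('k::field \<Rightarrow> 'a::{ring, monoid_mult} \<Rightarrow> 'a) \<Rightarrow> 'a set \<Rightarrow> 'a set set"
  where "Sub_Alg scaleA B = {S. subalgebra scaleA S \<and> B \<subseteq> S}"

definition galois_psi ::
  "('k::field \<Rightarrow> 'h::{ring, monoid_mult} \<Rightarrow> 'h) \<Rightarrow> ('h \<Rightarrow> ('h \<times> 'h \<Rightarrow>\<^sub>0 int) set) \<Rightarrow>
   ('h \<Rightarrow> 'k) \<Rightarrow> ('k \<Rightarrow> 'a::{ring, monoid_mult} \<Rightarrow> 'a) \<Rightarrow> ('a \<Rightarrow> ('a \<times> 'h \<Rightarrow>\<^sub>0 int) set) \<Rightarrow>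
   'a set \<Rightarrow> 'a set \<Rightarrow> 'h set set"
  where "galois_psi scaleH \<Delta> \<epsilon> scaleA \<delta> B =
    (\<lambda>S\<in>Sub_Alg scaleA B.
       \<Squnion>\<^bsub>Quot_gen scaleH \<Delta> \<epsilon>\<^esub>
         {Q \<in> carrier (Quot_gen scaleH \<Delta> \<epsilon>). S \<subseteq> coinvariants scaleH scaleA \<delta> Q})"

definition closed_Sub_Alg ::
  "('k::field \<Rightarrow> 'h::{ring, monoid_mult} \<Rightarrow> 'h) \<Rightarrow> ('h \<Rightarrow> ('h \<times> 'h \<Rightarrow>\<^sub>0 int) set) \<Rightarrow>
   ('h \<Rightarrow> 'k) \<Rightarrow> ('k \<Rightarrow> 'a::{ring, monoid_mult} \<Rightarrow> 'a) \<Rightarrow> ('a \<Rightarrow> ('a \<times> 'h \<Rightarrow>\<^sub>0 int) set) \<Rightarrow>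
   'a set \<Rightarrow> 'h set set \<Rightarrow> bool"
  where "closed_Sub_Alg scaleH \<Delta> \<epsilon> scaleA \<delta> B Q \<longleftrightarrow>
    galois_psi scaleH \<Delta> \<epsilon> scaleA \<delta> B (coinvariants scaleH scaleA \<delta> Q) = Q"

definition closed_Sub_gen ::
  "('k::field \<Rightarrow> 'h::{ring, monoid_mult} \<Rightarrow> 'h) \<Rightarrow> ('h \<Rightarrow> ('h \<times> 'h \<Rightarrow>\<^sub>0 int) set) \<Rightarrow>
   ('h \<Rightarrow> 'k) \<Rightarrow> 'h set set \<Rightarrow> bool"
  where "closed_Sub_gen scaleH \<Delta> \<epsilon> Q \<longleftrightarrow>
    Q = quot (plus_ideal scaleH \<epsilon> (coinvariants scaleH scaleH \<Delta> Q))"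


section \<open>The canonical map\<close>

definition tensor_over_subalgebra :: "'h::{plus, times} set \<Rightarrow> ('h \<times> 'h \<Rightarrow>\<^sub>0 int) set set"
  where "tensor_over_subalgebra K =
    tensor_carrier K
      \<lparr>elems = UNIV, madd = (+), mact = (\<lambda>r x. x * r)\<rparr>
      \<lparr>elems = UNIV, madd = (+), mact = (\<lambda>r x. r * x)\<rparr>"

definition can ::
  "('k \<Rightarrow> 'h::{plus, times} \<Rightarrow> 'h) \<Rightarrow> ('h \<Rightarrow> ('h \<times> 'h \<Rightarrow>\<^sub>0 int) set) \<Rightarrow> 'h set set \<Rightarrow>
   ('h \<times> 'h \<Rightarrow>\<^sub>0 int) set \<Rightarrow> ('h \<times> 'h set \<Rightarrow>\<^sub>0 int) set"
  where "can scaleH \<Delta> Q =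
    tensor_lift UNIV (vs scaleH) (quot_mod scaleH Q)
      (\<lambda>(h, h'). frag_extend (\<lambda>(u, v). frag_of (h * u, proj Q v)) (rep (\<Delta> h')))"

end

theory Submission
  imports Defs
begin

text \<open>
  Let \<open>Q = H/I\<close> and \<open>K = H\<^sup>c\<^sup>o\<^sup>Q\<close>. Both parts of the theorem compare \<open>I\<close> with the right ideal coideal \<open>K\<^sup>+H\<close>,
  which is always contained in \<open>I\<close>.

  For closed quotients, the point is that the coaction maps \<open>A\<^sup>c\<^sup>o\<^sup>Q\<close> into \<open>A \<otimes> K\<close>, by coassociativity. Modulo
  \<open>K\<^sup>+H\<close> every \<open>k \<in> K\<close> equals \<open>\<epsilon>(k) 1\<close>, so \<open>a \<in> A\<^sup>c\<^sup>o\<^sup>Q\<close> is coinvariant already for \<open>H/K\<^sup>+H\<close>. Therefore \<open>H/K\<^sup>+H\<close>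
  competes in the join that defines \<open>\<psi>(A\<^sup>c\<^sup>o\<^sup>Q)\<close>. If that join is \<open>Q\<close>, then \<open>I \<subseteq> K\<^sup>+H\<close>, and \<open>Q = H/K\<^sup>+H\<close> is closed for
  the connection with left coideal subalgebras (\<open>closed_Sub_Alg_imp_closed_Sub_gen\<close>). One needs that the
  join exists, that \<open>K\<close> is a left coideal subalgebra and that \<open>K\<^sup>+H\<close> is a coideal.

  For the canonical map, the antipode makes \<open>h \<otimes> g \<mapsto> h g\<^sub>1 \<otimes> g\<^sub>2\<close> a bijection of \<open>H \<otimes> H\<close>. It carries the
  \<open>K\<close>-balancing relators onto \<open>H \<otimes> K\<^sup>+H\<close>, hence turns \<open>can\<close> into the projection from \<open>H \<otimes> H/K\<^sup>+H\<close> onto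
  \<open>H \<otimes> H/I\<close>, which is bijective exactly when \<open>I = K\<^sup>+H\<close> (\<open>closed_Sub_gen_iff_can_bij\<close>).

  Tensors are classes of formal sums, and all computations with them are reduced to computations in
  \<open>H\<close>. Over a field, \<open>\<Sum> x\<^sub>i \<otimes> y\<^sub>i\<close> lies in \<open>M \<otimes> I\<close> as soon as \<open>\<Sum> \<phi>(x\<^sub>i) y\<^sub>i \<in> I\<close> for every linear functional \<open>\<phi>\<close>
  (\<open>tensor_split\<close>, \<open>quotient_tensor_zero_iff\<close>). Thus a coaction is known through its slices
  \<open>\<Sum> \<phi>(a\<^sub>0) a\<^sub>1\<close>: coinvariance under \<open>H/I\<close> means that the slice by \<open>\<phi>\<close> is \<open>\<phi>(a) 1\<close> modulo \<open>I\<close>, the coideal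
  condition on \<open>I\<close> means that slices by functionals vanishing on \<open>I\<close> preserve \<open>I\<close>, and coassociativity
  says that a slice of a slice is again a slice.
\<close>

section \<open>Finite sums of elementary tensors\<close>

text \<open>
  Quotients by subgroups are treated as congruences: two formal sums represent the same tensor when
  their difference lies in a difference-closed set of relators.
\<close>

definition diff_closed :: "'g::ab_group_add set \<Rightarrow> bool"
  where "diff_closed N \<longleftrightarrow> 0 \<in> N \<and> (\<forall>x\<in>N. \<forall>y\<in>N. x - y \<in> N)"

lemma diff_closedD:
  assumes "diff_closed N"
  shows "0 \<in> N" "x \<in> N \<Longrightarrow> y \<in> N \<Longrightarrow> x - y \<in> N" "x \<in> N \<Longrightarrow> - x \<in> N"
    "x \<in> N \<Longrightarrow> y \<in> N \<Longrightarrow> x + y \<in> N"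
proof -
  show z: "0 \<in> N" and d: "x \<in> N \<Longrightarrow> y \<in> N \<Longrightarrow> x - y \<in> N" for x y
    using assms by (auto simp: diff_closed_def)
  show m: "x \<in> N \<Longrightarrow> - x \<in> N" for x using d[OF z] by fastforce
  show "x \<in> N \<Longrightarrow> y \<in> N \<Longrightarrow> x + y \<in> N" using d[of x "- y"] m[of y] by simp
qed

lemma diff_closed_zero: "diff_closed {0}"
  by (simp add: diff_closed_def)

lemma diff_closed_trans:
  assumes "diff_closed N" "x - y \<in> N" "y - z \<in> N"
  shows "x - z \<in> N"
  using diff_closedD(4)[OF assms(1,2,3)] by simp

lemma diff_closed_sym:
  assumes "diff_closed N" "x - y \<in> N"
  shows "y - x \<in> N"
  using diff_closedD(3)[OF assms] by simp

lemma diff_closed_cong: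
  assumes "diff_closed N" "x - y \<in> N"
  shows "x \<in> N \<longleftrightarrow> y \<in> N"
proof
  show "y \<in> N" if "x \<in> N" using diff_closedD(2)[OF assms(1) that assms(2)] by simp
  show "x \<in> N" if "y \<in> N" using diff_closedD(4)[OF assms(1) assms(2) that] by simp
qed

lemma diff_closed_sum_diff:
  assumes "diff_closed N" "\<And>e. e \<in> E \<Longrightarrow> f e - g e \<in> N"
  shows "sum f E - sum g E \<in> N"
  unfolding sum_subtractf[symmetric] using assms(2)
  by (induction E rule: infinite_finite_induct)
    (auto intro: diff_closedD(1)[OF assms(1)] diff_closedD(4)[OF assms(1)])

lemma additive_frag_in:
  assumes "additive \<Phi>" "diff_closed N" "Poly_Mapping.keys t \<subseteq> S" "\<And>p. p \<in> S \<Longrightarrow> \<Phi> (frag_of p) \<in> N"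
  shows "\<Phi> t \<in> N"
  using assms(3)
proof (induction t rule: frag_induction)
  case zero then show ?case using additive.zero[OF assms(1)] diff_closedD(1)[OF assms(2)] by simp
next
  case (one p) then show ?case by (rule assms(4))
next
  case (diff a b) then show ?case
    by (simp add: additive.diff[OF assms(1)] diff_closedD(2)[OF assms(2)])
qed

lemma additive_frag_eq:
  assumes "additive \<Phi>" "additive \<Psi>" "Poly_Mapping.keys t \<subseteq> S"
    "\<And>p. p \<in> S \<Longrightarrow> \<Phi> (frag_of p) = \<Psi> (frag_of p)"
  shows "\<Phi> t = \<Psi> t"
  using assms(3) by (induction t rule: frag_induction)
    (simp_all add: additive.diff[OF assms(1)] additive.diff[OF assms(2)] assms(4)
      additive.zero[OF assms(1)] additive.zero[OF assms(2)])

lemma additive_diff_map: "additive \<Phi> \<Longrightarrow> additive \<Psi> \<Longrightarrow> additive (\<lambda>t. \<Phi> t - \<Psi> t)"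
  by (simp add: additive_def)

lemma additive_comp: "additive \<Phi> \<Longrightarrow> additive \<Psi> \<Longrightarrow> additive (\<lambda>t. \<Phi> (\<Psi> t))"
  by (simp add: additive_def)

lemma additive_id: "additive (\<lambda>t. t)"
  by (simp add: additive_def)

lemma additive_frag_extend: "additive (frag_extend b)"
  by (simp add: additive_def frag_extend_add)

lemma diff_closed_tensor_rel: "diff_closed (tensor_rel R M N)"
  by (auto simp: diff_closed_def intro: tensor_rel.intros)

text \<open>
  The universal property of \<open>M \<otimes>\<^sub>R N\<close> in the form in which it gets used: an additive map on formal sums
  descends to the tensor product, modulo a subgroup \<open>L\<close>, once it sends the three kinds of relators
  into \<open>L\<close>. Taking for \<open>L\<close> another set of relators compares two tensor products.
\<close>

lemma additive_tensor_rel: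
  assumes "additive \<Phi>" "diff_closed L" "t \<in> tensor_rel R M N"
    "\<And>m m' n. m \<in> elems M \<Longrightarrow> m' \<in> elems M \<Longrightarrow> n \<in> elems N \<Longrightarrow>
      \<Phi> (frag_of (madd M m m', n)) - \<Phi> (frag_of (m, n)) - \<Phi> (frag_of (m', n)) \<in> L"
    "\<And>m n n'. m \<in> elems M \<Longrightarrow> n \<in> elems N \<Longrightarrow> n' \<in> elems N \<Longrightarrow>
      \<Phi> (frag_of (m, madd N n n')) - \<Phi> (frag_of (m, n)) - \<Phi> (frag_of (m, n')) \<in> L"
    "\<And>r m n. r \<in> R \<Longrightarrow> m \<in> elems M \<Longrightarrow> n \<in> elems N \<Longrightarrow>
      \<Phi> (frag_of (mact M r m, n)) - \<Phi> (frag_of (m, mact N r n)) \<in> L"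
  shows "\<Phi> t \<in> L"
  using assms(3)
proof induction
  case zero then show ?case using additive.zero[OF assms(1)] diff_closedD(1)[OF assms(2)] by simp
next
  case (diff s t) then show ?case
    by (simp add: additive.diff[OF assms(1)] diff_closedD(2)[OF assms(2)])
qed (simp_all add: additive.diff[OF assms(1)] assms(4-6))

lemma vs_simps [simp]: "elems (vs s) = UNIV" "madd (vs s) = (+)" "mact (vs s) = s"
  by (simp_all add: vs_def)

lemma tensor_class_eq_iff:
  "tensor_class R M N s = tensor_class R M N t \<longleftrightarrow> s - t \<in> tensor_rel R M N"
proof -
  note dc = diff_closed_tensor_rel[of R M N]
  have mem: "x \<in> tensor_class R M N u \<longleftrightarrow> x - u \<in> tensor_rel R M N" for x u
    unfolding tensor_class_def by (auto simp: image_iff intro!: bexI[of _ "x - u"])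
  show ?thesis
  proof
    assume "tensor_class R M N s = tensor_class R M N t"
    then show "s - t \<in> tensor_rel R M N"
      using mem[of s t] mem[of s s] diff_closedD(1)[OF dc] by simp
  next
    assume st: "s - t \<in> tensor_rel R M N"
    show "tensor_class R M N s = tensor_class R M N t"
    proof (intro equalityI subsetI)
      show "x \<in> tensor_class R M N t" if "x \<in> tensor_class R M N s" for x
        using that diff_closed_trans[OF dc _ st] unfolding mem by blast
      show "x \<in> tensor_class R M N s" if "x \<in> tensor_class R M N t" for x
        using that diff_closed_trans[OF dc _ diff_closed_sym[OF dc st]] unfolding mem by blast
    qed
  qed
qed

lemma rep_tensor_class: "rep (tensor_class R M N t) - t \<in> tensor_rel R M N"
proof -
  have "t \<in> tensor_class R M N t"
    unfolding tensor_class_def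
    using diff_closedD(1)[OF diff_closed_tensor_rel[of R M N]] by (force simp: image_iff)
  then have "rep (tensor_class R M N t) \<in> tensor_class R M N t"
    unfolding rep_def by (rule someI)
  then show ?thesis by (auto simp: tensor_class_def)
qed

lemma tensor_class_rep:
  assumes "X \<in> tensor_carrier R M N"
  shows "tensor_class R M N (rep X) = X"
proof -
  obtain t where "X = tensor_class R M N t"
    using assms by (auto simp: tensor_carrier_def tensor_sums_def)
  then show ?thesis by (simp add: tensor_class_eq_iff rep_tensor_class)
qed

lemma tensor_class_plus:
  "{s + t |s t. s \<in> tensor_class R M N x \<and> t \<in> tensor_class R M N y} = tensor_class R M N (x + y)"
proof -
  note dc = diff_closed_tensor_rel[of R M N]
  show ?thesis
    unfolding tensor_class_def
  proof (intro equalityI subsetI)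
    fix z assume "z \<in> {s + t |s t. s \<in> (+) x ` tensor_rel R M N \<and> t \<in> (+) y ` tensor_rel R M N}"
    then obtain a b where ab: "a \<in> tensor_rel R M N" "b \<in> tensor_rel R M N" "z = (x + a) + (y + b)"
      by auto
    have "z = (x + y) + (a + b)" using ab(3) by (simp add: algebra_simps)
    then show "z \<in> (+) (x + y) ` tensor_rel R M N"
      using diff_closedD(4)[OF dc ab(1,2)] by blast
  next
    fix z assume "z \<in> (+) (x + y) ` tensor_rel R M N"
    then obtain a where a: "a \<in> tensor_rel R M N" "z = (x + y) + a" by auto
    then have "z = (x + a) + (y + 0)" by (simp add: algebra_simps)
    then show "z \<in> {s + t |s t. s \<in> (+) x ` tensor_rel R M N \<and> t \<in> (+) y ` tensor_rel R M N}"
      using diff_closedD(1)[OF dc] a(1) by blast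
  qed
qed

section \<open>Multilinear maps on tensors\<close>

text \<open>
  The linear extension of \<open>f\<close> to formal sums; \<^const>\<open>tensor_eval\<close> is its value at a chosen representative.
\<close>

definition lin_ext :: "('k::ring_1 \<Rightarrow> 'v::ab_group_add \<Rightarrow> 'v) \<Rightarrow> ('p \<Rightarrow> 'v) \<Rightarrow> ('p \<Rightarrow>\<^sub>0 int) \<Rightarrow> 'v"
  where "lin_ext s f t = (\<Sum>p\<in>Poly_Mapping.keys t. s (of_int (Poly_Mapping.lookup t p)) (f p))"

definition bilinear ::
  "('k::field \<Rightarrow> 'm::ab_group_add \<Rightarrow> 'm) \<Rightarrow> ('k \<Rightarrow> 'n::ab_group_add \<Rightarrow> 'n) \<Rightarrow>
   ('k \<Rightarrow> 'v::ab_group_add \<Rightarrow> 'v) \<Rightarrow> ('m \<Rightarrow> 'n \<Rightarrow> 'v) \<Rightarrow> bool"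
  where "bilinear sM sN sV f \<longleftrightarrow>
    (\<forall>y. Vector_Spaces.linear sM sV (\<lambda>x. f x y)) \<and> (\<forall>x. Vector_Spaces.linear sN sV (f x))"

definition trilinear ::
  "('k::field \<Rightarrow> 'm::ab_group_add \<Rightarrow> 'm) \<Rightarrow> ('k \<Rightarrow> 'n::ab_group_add \<Rightarrow> 'n) \<Rightarrow>
   ('k \<Rightarrow> 'l::ab_group_add \<Rightarrow> 'l) \<Rightarrow> ('k \<Rightarrow> 'v::ab_group_add \<Rightarrow> 'v) \<Rightarrow> ('m \<Rightarrow> 'n \<Rightarrow> 'l \<Rightarrow> 'v) \<Rightarrow> bool"
  where "trilinear sM sN sL sV f \<longleftrightarrow>
    (\<forall>z. bilinear sM sN sV (\<lambda>x y. f x y z)) \<and> (\<forall>x y. Vector_Spaces.linear sL sV (f x y))"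

lemma tensor_eval_lin_ext: "tensor_eval s f X = lin_ext s (\<lambda>(x, y). f x y) (rep X)"
  by (simp add: tensor_eval_def lin_ext_def split_def)

context vector_space begin

lemma lin_ext_superset:
  assumes "finite A" "Poly_Mapping.keys t \<subseteq> A"
  shows "lin_ext scale f t = (\<Sum>p\<in>A. scale (of_int (Poly_Mapping.lookup t p)) (f p))"
  unfolding lin_ext_def using assms
  by (intro sum.mono_neutral_left) (auto simp: in_keys_iff)

lemma additive_lin_ext: "additive (lin_ext scale (f :: 'd \<Rightarrow> 'b))"
proof
  fix s t :: "'d \<Rightarrow>\<^sub>0 int"
  let ?A = "Poly_Mapping.keys s \<union> Poly_Mapping.keys t"
  have "Poly_Mapping.keys (s + t) \<subseteq> ?A" by (rule keys_add)
  then show "lin_ext scale f (s + t) = lin_ext scale f s + lin_ext scale f t"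
    by (simp add: lin_ext_superset[of ?A] lookup_add scale_left_distrib sum.distrib)
qed

lemma lin_ext_of [simp]: "lin_ext scale f (frag_of p) = f p"
  by (simp add: lin_ext_def)

lemmas lin_ext_diff = additive.diff[OF additive_lin_ext]
lemmas lin_ext_add = additive.add[OF additive_lin_ext]

lemma lin_ext_frag_extend: "lin_ext scale f (frag_extend b t) = lin_ext scale (\<lambda>p. lin_ext scale f (b p)) t"
  by (rule additive_frag_eq[OF additive_comp[OF additive_lin_ext additive_frag_extend] additive_lin_ext subset_UNIV])
    simp

lemma diff_closed_subspace: "subspace W \<Longrightarrow> diff_closed W"
  by (simp add: diff_closed_def subspace_0 subspace_diff)

lemma lin_ext_in:
  assumes "subspace W" "\<And>p. p \<in> Poly_Mapping.keys t \<Longrightarrow> f p \<in> W"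
  shows "lin_ext scale f t \<in> W"
  unfolding lin_ext_def by (intro subspace_sum subspace_scale assms)

lemma lin_ext_plus: "lin_ext scale (\<lambda>p. f p + g p) t = lin_ext scale f t + lin_ext scale g t"
  by (simp add: lin_ext_def scale_right_distrib sum.distrib)

lemma lin_ext_minus: "lin_ext scale (\<lambda>p. f p - g p) t = lin_ext scale f t - lin_ext scale g t"
  by (simp add: lin_ext_def scale_right_diff_distrib sum_subtractf)

lemma lin_ext_scale: "lin_ext scale (\<lambda>p. scale c (f p)) t = scale c (lin_ext scale f t)"
  by (simp add: lin_ext_def scale_sum_right mult.commute)

text \<open>
  Two independent sums commute; in Sweedler notation this is what allows coproducts of different
  elements to be expanded in any order.
\<close>

lemma lin_ext_swap:
  "lin_ext scale (\<lambda>p. lin_ext scale (f p) t) u = lin_ext scale (\<lambda>q. lin_ext scale (\<lambda>p. f p q) u) t"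
  unfolding lin_ext_def scale_sum_right
  by (subst sum.swap) (simp add: mult.commute)

lemma linear_lin_ext:
  assumes "Vector_Spaces.linear scale s' g"
  shows "g (lin_ext scale f t) = lin_ext s' (\<lambda>p. g (f p)) t"
proof -
  interpret g: Vector_Spaces.linear scale s' g by (rule assms)
  show ?thesis by (simp add: lin_ext_def g.sum g.scale)
qed

lemma lin_ext_bilinear_tensor_rel:
  assumes "bilinear sM sN scale f" "t \<in> tensor_rel UNIV (vs sM) (vs sN)"
  shows "lin_ext scale (\<lambda>(x, y). f x y) t = 0"
proof -
  have "lin_ext scale (\<lambda>(x, y). f x y) t \<in> {0}"
    by (rule additive_tensor_rel[OF additive_lin_ext diff_closed_zero assms(2)])
      (use assms(1) in \<open>simp_all add: vs_def bilinear_def Vector_Spaces.linear_iff\<close>)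
  then show ?thesis by simp
qed

lemma lin_ext_bilinear_cong:
  assumes "bilinear sM sN scale f" "t - u \<in> tensor_rel UNIV (vs sM) (vs sN)"
  shows "lin_ext scale (\<lambda>(x, y). f x y) t = lin_ext scale (\<lambda>(x, y). f x y) u"
  using lin_ext_bilinear_tensor_rel[OF assms] by (simp add: lin_ext_diff)

lemma tensor_eval_class:
  assumes "bilinear sM sN scale f"
  shows "tensor_eval scale f (tensor_class UNIV (vs sM) (vs sN) t) = lin_ext scale (\<lambda>(x, y). f x y) t"
  unfolding tensor_eval_lin_ext by (rule lin_ext_bilinear_cong[OF assms rep_tensor_class])

lemma tensor_eval_plus:
  "tensor_eval scale (\<lambda>x y. f x y + g x y) X = tensor_eval scale f X + tensor_eval scale g X"
  by (simp add: tensor_eval_lin_ext split_def lin_ext_plus)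

lemma tensor_eval_minus:
  "tensor_eval scale (\<lambda>x y. f x y - g x y) X = tensor_eval scale f X - tensor_eval scale g X"
  by (simp add: tensor_eval_lin_ext split_def lin_ext_minus)

lemma tensor_eval_scale:
  "tensor_eval scale (\<lambda>x y. scale c (f x y)) X = scale c (tensor_eval scale f X)"
  by (simp add: tensor_eval_lin_ext split_def lin_ext_scale)

lemma tensor_eval_swap:
  "tensor_eval scale (\<lambda>x y. tensor_eval scale (f x y) Y) X =
   tensor_eval scale (\<lambda>u v. tensor_eval scale (\<lambda>x y. f x y u v) X) Y"
  unfolding tensor_eval_lin_ext split_def by (rule lin_ext_swap)

lemma tensor_eval_in:
  assumes "subspace W" "\<And>x y. f x y \<in> W"
  shows "tensor_eval scale f X \<in> W"
  unfolding tensor_eval_lin_ext by (rule lin_ext_in[OF assms(1)]) (auto simp: assms(2))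

lemma linear_tensor_eval:
  assumes "Vector_Spaces.linear scale s' g"
  shows "g (tensor_eval scale f X) = tensor_eval s' (\<lambda>x y. g (f x y)) X"
  unfolding tensor_eval_lin_ext linear_lin_ext[OF assms] by (simp add: split_def)

lemma linear_tensor_eval_family:
  assumes "\<And>x y. Vector_Spaces.linear s' scale (\<lambda>z. f z x y)"
  shows "Vector_Spaces.linear s' scale (\<lambda>z. tensor_eval scale (f z) X)"
proof -
  have "f (x + y) = (\<lambda>a b. f x a b + f y a b)" "f (s' c x) = (\<lambda>a b. scale c (f x a b))" for x y c
    using assms[unfolded Vector_Spaces.linear_iff] by (intro ext; blast)+
  then show ?thesis
    using assms[of undefined undefined]
    by (simp add: Vector_Spaces.linear_iff tensor_eval_plus tensor_eval_scale)
qed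

end

lemma linear_zero: "Vector_Spaces.linear s s' f \<Longrightarrow> f 0 = 0"
  using additive.zero[of f] by (simp add: additive_def Vector_Spaces.linear_iff)

lemma tensor_class_in_sums_iff:
  "tensor_class R M N t \<in> tensor_sums R M N P \<longleftrightarrow>
    (\<exists>t'. Poly_Mapping.keys t' \<subseteq> P \<and> t - t' \<in> tensor_rel R M N)"
  by (auto simp: tensor_sums_def tensor_class_eq_iff image_iff)

section \<open>Functionals detect tensors over a field\<close>

locale vector_space_tensor = vs1: vector_space s1 + vs2: vector_space s2
  for s1 :: "'k::field \<Rightarrow> 'm::ab_group_add \<Rightarrow> 'm" and s2 :: "'k \<Rightarrow> 'n::ab_group_add \<Rightarrow> 'n"
begin

abbreviation trel :: "('m \<times> 'n \<Rightarrow>\<^sub>0 int) set"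
  where "trel \<equiv> tensor_rel UNIV (vs s1) (vs s2)"

lemmas trel_closed = diff_closed_tensor_rel[of UNIV "vs s1" "vs s2"]

lemma bilinear_functional:
  assumes "Vector_Spaces.linear s1 (*) \<phi>"
  shows "bilinear s1 s2 s2 (\<lambda>x y. s2 (\<phi> x) y)"
  using assms vs1.vector_space_axioms vs2.vector_space_axioms
  by (simp add: bilinear_def Vector_Spaces.linear_iff vs2.scale_left_distrib vs2.scale_right_distrib mult.commute)

lemma trel_add_left: "frag_of (x + x', y) - (frag_of (x, y) + frag_of (x', y)) \<in> trel"
  using tensor_rel.add_left[where M = "vs s1" and N = "vs s2" and R = UNIV and m = x and m' = x' and n = y]
  by (simp add: vs_def algebra_simps)

lemma trel_add_right: "frag_of (x, y + y') - (frag_of (x, y) + frag_of (x, y')) \<in> trel"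
  using tensor_rel.add_right[where M = "vs s1" and N = "vs s2" and R = UNIV and m = x and n = y and n' = y']
  by (simp add: vs_def algebra_simps)

lemma trel_scale: "frag_of (s1 c x, y) - frag_of (x, s2 c y) \<in> trel"
  using tensor_rel.balanced[where M = "vs s1" and N = "vs s2" and R = UNIV and r = c and m = x and n = y]
  by (simp add: vs_def)

lemma trel_zero_left: "frag_of (0, y) \<in> trel"
  using diff_closedD(3)[OF trel_closed trel_add_left[of 0 0 y]] by simp

lemma trel_zero_right: "frag_of (x, 0) \<in> trel"
  using diff_closedD(3)[OF trel_closed trel_add_right[of x 0 0]] by simp

lemma trel_diff_right: "frag_of (x, y - y') - (frag_of (x, y) - frag_of (x, y')) \<in> trel"
  using diff_closedD(3)[OF trel_closed trel_add_right[of x "y - y'" y']] by (simp add: algebra_simps)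

lemma trel_sum_left: "frag_of (\<Sum>e\<in>E. f e, y) - (\<Sum>e\<in>E. frag_of (f e, y)) \<in> trel"
proof (induction E rule: infinite_finite_induct)
  case (insert e E)
  then show ?case
    using diff_closedD(4)[OF trel_closed trel_add_left[of "f e" "sum f E" y] insert.IH]
    by (simp add: algebra_simps)
qed (simp_all add: trel_zero_left)

text \<open>
  Expanding every left factor in a basis \<open>B\<close> rewrites a tensor as \<open>\<Sum>e. e \<otimes> (e\<^sup>* \<otimes> id)(t)\<close>, where \<open>e\<^sup>*\<close>
  runs through the coordinate functionals. Hence functionals on the left factor see everything in a
  tensor product over a field.
\<close>

lemma tensor_basis_expansion:
  assumes B: "vs1.independent B" "vs1.span B = UNIV" and E: "finite E"
    and t: "Poly_Mapping.keys t \<subseteq> {(x, y). {b. vs1.representation B x b \<noteq> 0} \<subseteq> E}"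
  shows "t - (\<Sum>e\<in>E. frag_of (e, lin_ext s2 (\<lambda>(x, y). s2 (vs1.representation B x e) y) t)) \<in> trel"
  using t
proof (induction t rule: frag_induction)
  case zero
  show ?case using diff_closed_sum_diff[OF trel_closed, of E "\<lambda>e. 0" "\<lambda>e. frag_of (e, 0)"]
    by (simp add: trel_zero_right diff_closedD(3)[OF trel_closed] additive.zero[OF vs2.additive_lin_ext])
next
  case (one p)
  obtain x y where p: "p = (x, y)" and xE: "{b. vs1.representation B x b \<noteq> 0} \<subseteq> E"
    using one by auto
  have "(\<Sum>e\<in>E. s1 (vs1.representation B x e) e) = (\<Sum>e | vs1.representation B x e \<noteq> 0. s1 (vs1.representation B x e) e)"
    using E xE by (intro sum.mono_neutral_right) auto
  also have "\<dots> = x"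
    using B by (intro vs1.sum_nonzero_representation_eq) auto
  finally have x: "(\<Sum>e\<in>E. s1 (vs1.representation B x e) e) = x" .
  have "(\<Sum>e\<in>E. frag_of (s1 (vs1.representation B x e) e, y)) -
      (\<Sum>e\<in>E. frag_of (e, s2 (vs1.representation B x e) y)) \<in> trel"
    by (rule diff_closed_sum_diff[OF trel_closed trel_scale])
  with trel_sum_left[of "\<lambda>e. s1 (vs1.representation B x e) e" E y]
  show ?case
    using diff_closed_trans[OF trel_closed] unfolding x by (simp add: p)
next
  case (diff a b)
  let ?f = "\<lambda>e t. lin_ext s2 (\<lambda>(x, y). s2 (vs1.representation B x e) y) t"
  have 1: "(\<Sum>e\<in>E. frag_of (e, ?f e (a - b))) - (\<Sum>e\<in>E. frag_of (e, ?f e a) - frag_of (e, ?f e b)) \<in> trel"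
    by (rule diff_closed_sum_diff[OF trel_closed]) (simp only: vs2.lin_ext_diff trel_diff_right)
  have "(a - b) - (\<Sum>e\<in>E. frag_of (e, ?f e a) - frag_of (e, ?f e b)) \<in> trel"
    using diff_closedD(2)[OF trel_closed diff.IH] by (simp add: sum_subtractf algebra_simps)
  from diff_closed_trans[OF trel_closed this diff_closed_sym[OF trel_closed 1]] show ?case .
qed

text \<open>
  A basis of \<open>J\<close> extended to the whole space splits the basis expansion in two: the terms with \<open>e \<in> J\<close>,
  and the terms with \<open>e \<notin> J\<close>, for which the coordinate functional vanishes on \<open>J\<close> and the hypothesis
  puts the right factor into \<open>I\<close>. Basis vectors are nonzero, which is recorded by \<open>J - {0}\<close> so that
  \<open>J = {0}\<close> leaves only terms with right factor in \<open>I\<close>.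
\<close>

lemma tensor_split:
  assumes J: "vs1.subspace J"
    and I: "\<forall>\<phi>. Vector_Spaces.linear s1 (*) \<phi> \<longrightarrow> (\<forall>x\<in>J. \<phi> x = 0) \<longrightarrow>
      lin_ext s2 (\<lambda>(x, y). s2 (\<phi> x) y) t \<in> I"
  shows "\<exists>t'. Poly_Mapping.keys t' \<subseteq> (J - {0}) \<times> UNIV \<union> UNIV \<times> I \<and> t - t' \<in> trel"
proof -
  obtain C where C: "C \<subseteq> J" "vs1.independent C" "J \<subseteq> vs1.span C"
    using vs1.maximal_independent_subset by blast
  define B where "B = vs1.extend_basis C"
  have B: "vs1.independent B" "vs1.span B = UNIV" "C \<subseteq> B"
    unfolding B_def using C(2) vs1.independent_extend_basis vs1.span_extend_basis vs1.extend_basis_superset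
    by auto
  let ?R = "vs1.representation B"
  define E where "E = (\<Union>(x, y)\<in>Poly_Mapping.keys t. {b. ?R x b \<noteq> 0})"
  have E: "finite E" unfolding E_def by (auto intro: vs1.finite_representation)
  have EB: "E \<subseteq> B" unfolding E_def by (auto dest: vs1.representation_ne_zero)
  have tE: "Poly_Mapping.keys t \<subseteq> {(x, y). {b. ?R x b \<noteq> 0} \<subseteq> E}" unfolding E_def by auto
  let ?t' = "\<Sum>e\<in>E. frag_of (e, lin_ext s2 (\<lambda>(x, y). s2 (?R x e) y) t)"
  have "(e, lin_ext s2 (\<lambda>(x, y). s2 (?R x e) y) t) \<in> (J - {0}) \<times> UNIV \<union> UNIV \<times> I" if e: "e \<in> E" for e
  proof (cases "e \<in> C")
    case True
    moreover have "e \<noteq> 0" using C(2) True vs1.dependent_zero by blast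
    ultimately show ?thesis using C(1) by auto
  next
    case False
    have lin: "Vector_Spaces.linear s1 (*) (\<lambda>x. ?R x e)" by (rule vs1.linear_representation[OF B(1,2)])
    have "?R x e = 0" if x: "x \<in> J" for x
    proof -
      have "?R x = vs1.representation C x"
        by (rule vs1.representation_extend) (use B x C in auto)
      then show ?thesis using False vs1.representation_ne_zero[of C x e] by auto
    qed
    then show ?thesis using I[rule_format, OF lin] by simp
  qed
  then have "Poly_Mapping.keys ?t' \<subseteq> (J - {0}) \<times> UNIV \<union> UNIV \<times> I"
    using keys_sum[of "\<lambda>e. frag_of (e, lin_ext s2 (\<lambda>(x, y). s2 (?R x e) y) t)" E]
    by fastforce
  then show ?thesis using tensor_basis_expansion[OF B(1,2) E tE] by blast
qed

text \<open>
  The criterion for \<open>t \<in> J \<otimes> N + M \<otimes> I\<close>, in which form the coideal condition enters.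
\<close>

lemma tensor_split_iff:
  assumes J: "vs1.subspace J" and I: "vs2.subspace I"
  shows "tensor_class UNIV (vs s1) (vs s2) t \<in> tensor_sums UNIV (vs s1) (vs s2) (J \<times> UNIV \<union> UNIV \<times> I) \<longleftrightarrow>
    (\<forall>\<phi>. Vector_Spaces.linear s1 (*) \<phi> \<longrightarrow> (\<forall>x\<in>J. \<phi> x = 0) \<longrightarrow>
      lin_ext s2 (\<lambda>(x, y). s2 (\<phi> x) y) t \<in> I)" (is "?l \<longleftrightarrow> ?r")
proof
  assume ?l
  then obtain t' where t': "Poly_Mapping.keys t' \<subseteq> J \<times> UNIV \<union> UNIV \<times> I" "t - t' \<in> trel"
    unfolding tensor_class_in_sums_iff by blast
  show ?r
  proof (intro allI impI)
    fix \<phi> assume \<phi>: "Vector_Spaces.linear s1 (*) \<phi>" "\<forall>x\<in>J. \<phi> x = 0"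
    have "lin_ext s2 (\<lambda>(x, y). s2 (\<phi> x) y) t' \<in> I"
      by (rule vs2.lin_ext_in[OF I]) (use t'(1) \<phi>(2) I in \<open>auto simp: vs2.subspace_0 vs2.subspace_scale\<close>)
    then show "lin_ext s2 (\<lambda>(x, y). s2 (\<phi> x) y) t \<in> I"
      unfolding vs2.lin_ext_bilinear_cong[OF bilinear_functional[OF \<phi>(1)] t'(2)] .
  qed
next
  assume r: ?r
  obtain t' where "Poly_Mapping.keys t' \<subseteq> (J - {0}) \<times> UNIV \<union> UNIV \<times> I" "t - t' \<in> trel"
    using tensor_split[OF J r] by blast
  then show ?l unfolding tensor_class_in_sums_iff by blast
qed

lemma tensor_right:
  assumes "\<forall>\<phi>. Vector_Spaces.linear s1 (*) \<phi> \<longrightarrow> lin_ext s2 (\<lambda>(x, y). s2 (\<phi> x) y) t \<in> I"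
  shows "\<exists>t'. Poly_Mapping.keys t' \<subseteq> UNIV \<times> I \<and> t - t' \<in> trel"
  using tensor_split[OF vs1.subspace_single_0, of t I] assms by simp

lemma tensor_right_iff:
  assumes I: "vs2.subspace I"
  shows "tensor_class UNIV (vs s1) (vs s2) t \<in> tensor_sums UNIV (vs s1) (vs s2) (UNIV \<times> I) \<longleftrightarrow>
    (\<forall>\<phi>. Vector_Spaces.linear s1 (*) \<phi> \<longrightarrow> lin_ext s2 (\<lambda>(x, y). s2 (\<phi> x) y) t \<in> I)" (is "?l \<longleftrightarrow> ?r")
proof
  assume ?l
  then have "tensor_class UNIV (vs s1) (vs s2) t \<in> tensor_sums UNIV (vs s1) (vs s2) ({0} \<times> UNIV \<union> UNIV \<times> I)"
    unfolding tensor_class_in_sums_iff by blast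
  then have *: "Vector_Spaces.linear s1 (*) \<phi> \<Longrightarrow> \<phi> 0 = 0 \<Longrightarrow> lin_ext s2 (\<lambda>(x, y). s2 (\<phi> x) y) t \<in> I" for \<phi>
    unfolding tensor_split_iff[OF vs1.subspace_single_0 I] by simp
  show ?r
  proof (intro allI impI)
    fix \<phi> assume \<phi>: "Vector_Spaces.linear s1 (*) \<phi>"
    show "lin_ext s2 (\<lambda>(x, y). s2 (\<phi> x) y) t \<in> I" by (rule *[OF \<phi> linear_zero[OF \<phi>]])
  qed
next
  assume r: ?r
  obtain t' where "Poly_Mapping.keys t' \<subseteq> UNIV \<times> I" "t - t' \<in> trel"
    using tensor_right[OF r] by blast
  then show ?l unfolding tensor_class_in_sums_iff by blast
qed

lemma keys_right_tensor_rel: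
  assumes "Poly_Mapping.keys t \<subseteq> UNIV \<times> {0}"
  shows "t \<in> trel"
  using additive_frag_in[OF additive_id trel_closed assms] trel_zero_right by auto

lemma tensor_zero_iff:
  "t \<in> trel \<longleftrightarrow> (\<forall>\<phi>. Vector_Spaces.linear s1 (*) \<phi> \<longrightarrow> lin_ext s2 (\<lambda>(x, y). s2 (\<phi> x) y) t = 0)"
    (is "?l \<longleftrightarrow> ?r")
proof
  assume r: ?r
  obtain t' where t': "Poly_Mapping.keys t' \<subseteq> UNIV \<times> {0}" "t - t' \<in> trel"
    using tensor_right[of t "{0}"] r by auto
  then show ?l using diff_closed_cong[OF trel_closed] keys_right_tensor_rel by blast
qed (use vs2.lin_ext_bilinear_tensor_rel[OF bilinear_functional] in blast)

end

section \<open>Cosets of a subspace\<close>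

context vector_space begin

text \<open>
  Cosets are equivalence classes, so the coset picked by \<^const>\<open>proj\<close> is unique and explicit.
\<close>

lemma proj_quot:
  assumes I: "subspace I"
  shows "proj (quot I) h = {y. h - y \<in> I}"
proof -
  note dc = diff_closed_subspace[OF I]
  have eq: "equiv UNIV {(x, y). x - y \<in> I}"
    by (intro equivI refl_onI symI transI)
      (auto intro: diff_closedD(1)[OF dc] diff_closed_sym[OF dc] diff_closed_trans[OF dc])
  have cls: "{y. h - y \<in> I} = {(x, y). x - y \<in> I} `` {h}" by auto
  show ?thesis
    unfolding proj_def
  proof (rule the_equality)
    have "{y. h - y \<in> I} \<in> quot I" unfolding quot_def cls by (rule quotientI) simp
    then show "{y. h - y \<in> I} \<in> quot I \<and> h \<in> {y. h - y \<in> I}"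
      by (simp add: diff_closedD(1)[OF dc])
  next
    fix X assume X: "X \<in> quot I \<and> h \<in> X"
    then obtain z where "X = {(x, y). x - y \<in> I} `` {z}" by (auto simp: quot_def elim: quotientE)
    with X show "X = {y. h - y \<in> I}"
      using equiv_class_eq[OF eq, of z h] unfolding cls by auto
  qed
qed

lemma proj_quot_eq_iff:
  assumes "subspace I"
  shows "proj (quot I) x = proj (quot I) y \<longleftrightarrow> x - y \<in> I"
proof -
  note dc = diff_closed_subspace[OF assms]
  show ?thesis unfolding proj_quot[OF assms]
  proof
    assume "{z. x - z \<in> I} = {z. y - z \<in> I}"
    then have "y \<in> {z. x - z \<in> I}" using diff_closedD(1)[OF dc] by simp
    then show "x - y \<in> I" by simp
  next
    assume xy: "x - y \<in> I"
    show "{z. x - z \<in> I} = {z. y - z \<in> I}"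
      using diff_closed_trans[OF dc xy] diff_closed_trans[OF dc diff_closed_sym[OF dc xy]]
      by auto
  qed
qed

lemma proj_in_quot:
  assumes "subspace I"
  shows "proj (quot I) h \<in> quot I"
  unfolding proj_quot[OF assms] unfolding quot_def by (auto simp: quotient_def)

lemma quot_cases:
  assumes "subspace I" "X \<in> quot I"
  obtains h where "X = proj (quot I) h"
proof -
  obtain h where "X = {y. h - y \<in> I}" using assms(2) by (auto simp: quot_def quotient_def)
  then show thesis using that proj_quot[OF assms(1)] by simp
qed

lemma quot_inject:
  assumes "subspace I" "subspace J" "quot I = quot J"
  shows "I = J"
proof -
  have "x \<in> I \<longleftrightarrow> x \<in> J" for x
    using proj_quot_eq_iff[OF assms(1), of x 0] proj_quot_eq_iff[OF assms(2), of x 0] assms(3) by simp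
  then show ?thesis by blast
qed

lemma proj_rep:
  assumes "subspace I" "X \<in> quot I"
  shows "proj (quot I) (rep X) = X"
proof -
  obtain h where X: "X = {y. h - y \<in> I}"
    using quot_cases[OF assms] proj_quot[OF assms(1)] by metis
  have "h \<in> X" unfolding X using assms(1) by (simp add: subspace_0)
  then have "rep X \<in> X" unfolding rep_def by (rule someI)
  then have "h - rep X \<in> I" unfolding X by simp
  then show ?thesis
    using proj_quot_eq_iff[OF assms(1), of h "rep X"] X proj_quot[OF assms(1)] by auto
qed

lemma rep_proj:
  assumes "subspace I"
  shows "rep (proj (quot I) h) - h \<in> I"
  using proj_rep[OF assms proj_in_quot[OF assms]] by (simp add: proj_quot_eq_iff[OF assms])

lemma elems_quot_mod: "elems (quot_mod scale Q) = Q"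
  by (simp add: quot_mod_def)

lemma madd_quot_mod:
  assumes I: "subspace I"
  shows "madd (quot_mod scale (quot I)) (proj (quot I) x) (proj (quot I) y) = proj (quot I) (x + y)"
proof -
  have "(\<exists>a b. z = a + b \<and> x - a \<in> I \<and> y - b \<in> I) \<longleftrightarrow> x + y - z \<in> I" for z
  proof
    assume "\<exists>a b. z = a + b \<and> x - a \<in> I \<and> y - b \<in> I"
    then obtain a b where ab: "z = a + b" "x - a \<in> I" "y - b \<in> I" by blast
    have "x + y - z = (x - a) + (y - b)" by (simp add: ab(1))
    then show "x + y - z \<in> I" using subspace_add[OF I ab(2,3)] by metis
  next
    assume "x + y - z \<in> I"
    then show "\<exists>a b. z = a + b \<and> x - a \<in> I \<and> y - b \<in> I"
      by (intro exI[of _ x] exI[of _ "z - x"]) (simp add: subspace_0[OF I] algebra_simps)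
  qed
  then show ?thesis unfolding quot_mod_def by (simp add: proj_quot[OF I])
qed

lemma mact_quot_mod:
  assumes I: "subspace I"
  shows "mact (quot_mod scale (quot I)) c (proj (quot I) x) = proj (quot I) (scale c x)"
  using subspace_scale[OF I rep_proj[OF I], of c x]
  by (simp add: quot_mod_def proj_quot_eq_iff[OF I] scale_right_diff_distrib)

end

section \<open>Sweedler sums\<close>

lemma bilinear_vector_space: "bilinear sM sN sV f \<Longrightarrow> vector_space sV"
  by (simp add: bilinear_def Vector_Spaces.linear_iff)

lemma trilinear_vector_space: "trilinear sM sN sL sV f \<Longrightarrow> vector_space sV"
  by (simp add: trilinear_def Vector_Spaces.linear_iff)

context vector_space begin

lemma tensor_eval_pure:
  assumes "bilinear sM sN scale f"
  shows "tensor_eval scale f (pure_tensor (vs sM) (vs sN) x y) = f x y"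
  unfolding pure_tensor_def tensor_eval_class[OF assms] by simp

lemma tensor_eval_madd:
  assumes f: "bilinear sM sN scale f"
    and X: "X \<in> tensor_carrier UNIV (vs sM) (vs sN)" and Y: "Y \<in> tensor_carrier UNIV (vs sM) (vs sN)"
  shows "tensor_eval scale f (madd (tensor (vs sM) (vs sN)) X Y) = tensor_eval scale f X + tensor_eval scale f Y"
proof -
  have "madd (tensor (vs sM) (vs sN)) X Y = tensor_class UNIV (vs sM) (vs sN) (rep X + rep Y)"
    using tensor_class_plus[of UNIV "vs sM" "vs sN" "rep X" "rep Y"]
    unfolding tensor_class_rep[OF X] tensor_class_rep[OF Y] by (simp add: tensor_def)
  then show ?thesis
    by (simp add: tensor_eval_class[OF f] lin_ext_add) (simp add: tensor_eval_lin_ext)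
qed

lemma tensor_eval_mact:
  assumes f: "bilinear sM sN scale f"
  shows "tensor_eval scale f (mact (tensor (vs sM) (vs sN)) c X) = scale c (tensor_eval scale f X)"
proof -
  have c: "f (sM c x) y = scale c (f x y)" for x y
    using f by (simp add: bilinear_def Vector_Spaces.linear_iff)
  show ?thesis
    by (simp add: tensor_def tensor_lift_def tensor_eval_class[OF f])
      (simp add: lin_ext_frag_extend split_def c lin_ext_scale tensor_eval_lin_ext)
qed

end

lemma elems_tensor: "elems (tensor M N) = tensor_carrier UNIV M N"
  by (simp add: tensor_def)

text \<open>
  \<open>H\<close> coacts on itself by its comultiplication, so every statement about \<open>A\<close> specialises to \<open>H\<close>.
\<close>

lemma (in hopf_algebra) regular: "comodule_algebra scaleH \<Delta> \<epsilon> antipode scaleH \<Delta>"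
  by unfold_locales
    (fact comult_linear comult_coassoc counit_right comult_mult comult_one)+

sublocale hopf_algebra \<subseteq> HH: vector_space_tensor scaleH scaleH ..

sublocale comodule_algebra \<subseteq> AH: vector_space_tensor scaleA scaleH ..

context comodule_algebra begin

lemma coaction_carrier: "\<delta> a \<in> tensor_carrier UNIV (vs scaleA) (vs scaleH)"
  using coaction_linear by (simp add: linear_into_def elems_tensor)

lemma linear_coaction_eval:
  assumes f: "bilinear scaleA scaleH s f"
  shows "Vector_Spaces.linear scaleA s (\<lambda>a. tensor_eval s f (\<delta> a))"
proof -
  interpret V: vector_space s by (rule bilinear_vector_space[OF f])
  show ?thesis
    using coaction_linear A.vector_space_axioms V.vector_space_axioms
    by (simp add: Vector_Spaces.linear_iff linear_into_def V.tensor_eval_madd[OF f]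
        V.tensor_eval_mact[OF f] coaction_carrier)
qed

lemma coaction_eval_one:
  assumes f: "bilinear scaleA scaleH s f"
  shows "tensor_eval s f (\<delta> 1) = f 1 1"
  unfolding coaction_one by (rule vector_space.tensor_eval_pure[OF bilinear_vector_space[OF f] f])

lemma coaction_eval_mult:
  assumes f: "bilinear scaleA scaleH s f"
  shows "tensor_eval s f (\<delta> (a * b)) =
    tensor_eval s (\<lambda>x u. tensor_eval s (\<lambda>y v. f (x * y) (u * v)) (\<delta> b)) (\<delta> a)"
proof -
  interpret V: vector_space s by (rule bilinear_vector_space[OF f])
  show ?thesis
    unfolding coaction_mult tensor_mult_def V.tensor_eval_class[OF f]
    by (simp add: V.lin_ext_frag_extend split_def tensor_eval_lin_ext)
qed

text \<open>
  Coassociativity for Sweedler sums: applying the trilinear map \<open>f\<close> to both sides of the equation in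
  \<open>(A \<otimes> H) \<otimes> H\<close> gives \<open>\<Sum> f(a\<^sub>0\<^sub>0, a\<^sub>0\<^sub>1, a\<^sub>1) = \<Sum> f(a\<^sub>0, a\<^sub>1\<^sub>1, a\<^sub>1\<^sub>2)\<close>. On that iterated tensor product the
  first two arguments are evaluated as a Sweedler sum, the third one stays a parameter.
\<close>

lemma coaction_eval_coassoc:
  assumes f: "trilinear scaleA scaleH scaleH s f"
  shows "tensor_eval s (\<lambda>x w. tensor_eval s (\<lambda>y v. f y v w) (\<delta> x)) (\<delta> a) =
    tensor_eval s (\<lambda>x w. tensor_eval s (\<lambda>u v. f x u v) (\<Delta> w)) (\<delta> a)"
proof -
  interpret V: vector_space s by (rule trilinear_vector_space[OF f])
  let ?M = "vs scaleA" and ?H = "vs scaleH"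
  let ?MH = "tensor ?M ?H"
  have f2: "bilinear scaleA scaleH s (\<lambda>y v. f y v w)" for w
    using f by (simp add: trilinear_def)
  have lin3: "Vector_Spaces.linear scaleH s (\<lambda>w. tensor_eval s (\<lambda>y v. f y v w) X)" for X
    by (rule V.linear_tensor_eval_family) (use f in \<open>simp add: trilinear_def\<close>)
  let ?g = "\<lambda>(X, w). tensor_eval s (\<lambda>y v. f y v w) X"
  let ?l = "frag_extend (\<lambda>(x, y). frag_of (\<delta> x, id y)) (rep (\<delta> a))"
  let ?r = "frag_extend (\<lambda>(x, y). frag_extend (\<lambda>(u, v). frag_of (pure_tensor ?M ?H x u, v)) (rep (\<Delta> y)))
      (rep (\<delta> a))"
  have "?l - ?r \<in> tensor_rel UNIV ?MH ?H"
    using coaction_coassoc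
    unfolding coassociative_def tensor_map_def tensor_lift_def tensor_class_eq_iff by blast
  then have "lin_ext s ?g (?l - ?r) \<in> {0}"
    by (rule additive_tensor_rel[OF V.additive_lin_ext diff_closed_zero])
      (use lin3 in \<open>simp_all add: elems_tensor V.tensor_eval_madd[OF f2] V.tensor_eval_mact[OF f2]
        Vector_Spaces.linear_iff\<close>)
  then have "lin_ext s ?g ?l = lin_ext s ?g ?r"
    by (simp add: V.lin_ext_diff)
  then show ?thesis
    by (simp add: V.lin_ext_frag_extend split_def tensor_eval_lin_ext[of s _ "\<delta> _"]
        tensor_eval_lin_ext[of s _ "\<Delta> _"] V.tensor_eval_pure[OF f2])
qed

end

section \<open>Tensors with a quotient space\<close>

context vector_space begin

lemma rep_madd_quot_mod:
  assumes I: "subspace I" and X: "X \<in> quot I" and Y: "Y \<in> quot I"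
  shows "rep (madd (quot_mod scale (quot I)) X Y) - (rep X + rep Y) \<in> I"
  using madd_quot_mod[OF I, of "rep X" "rep Y"] rep_proj[OF I, of "rep X + rep Y"]
  by (simp add: proj_rep[OF I X] proj_rep[OF I Y])

lemma rep_mact_quot_mod:
  assumes I: "subspace I"
  shows "rep (mact (quot_mod scale (quot I)) c X) - scale c (rep X) \<in> I"
  using rep_proj[OF I] by (simp add: quot_mod_def)

end

context vector_space_tensor begin

lemma project_lift:
  assumes I: "vs2.subspace I" and Z: "Poly_Mapping.keys Z \<subseteq> UNIV \<times> quot I"
  shows "frag_extend (\<lambda>(x, y). frag_of (x, proj (quot I) y)) (frag_extend (\<lambda>(x, X). frag_of (x, rep X)) Z) = Z"
  by (rule additive_frag_eq[OF additive_comp[OF additive_frag_extend additive_frag_extend] additive_id Z])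
    (auto simp: vs2.proj_rep[OF I])

text \<open>
  The kernel of \<open>id \<otimes> \<pi>\<close> is \<open>M \<otimes> I\<close>. A functional on \<open>M\<close> maps \<open>M \<otimes> N/I\<close> to \<open>N/I\<close>, so vanishing is
  necessary. Conversely a lift of \<open>Z\<close> to \<open>M \<otimes> N\<close> that all functionals map into \<open>I\<close> lies in \<open>M \<otimes> I\<close>, and
  \<open>id \<otimes> \<pi>\<close> kills that.
\<close>

lemma quotient_tensor_zero_iff:
  assumes I: "vs2.subspace I" and Z: "Poly_Mapping.keys Z \<subseteq> UNIV \<times> quot I"
  shows "Z \<in> tensor_rel UNIV (vs s1) (quot_mod s2 (quot I)) \<longleftrightarrow>
    (\<forall>\<phi>. Vector_Spaces.linear s1 (*) \<phi> \<longrightarrow> lin_ext s2 (\<lambda>(x, X). s2 (\<phi> x) (rep X)) Z \<in> I)"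
    (is "?l \<longleftrightarrow> ?r")
proof
  let ?N = "quot_mod s2 (quot I)"
  note rc = diff_closed_tensor_rel[of UNIV "vs s1" ?N]
  note Ic = vs2.diff_closed_subspace[OF I]
  show ?r if l: ?l
  proof (intro allI impI)
    fix \<phi> assume \<phi>: "Vector_Spaces.linear s1 (*) \<phi>"
    let ?f = "\<lambda>(x, X). s2 (\<phi> x) (rep X)"
    show "lin_ext s2 ?f Z \<in> I"
    proof (rule additive_tensor_rel[OF vs2.additive_lin_ext Ic l])
      fix m m' n
      show "lin_ext s2 ?f (frag_of (madd (vs s1) m m', n)) - lin_ext s2 ?f (frag_of (m, n)) -
          lin_ext s2 ?f (frag_of (m', n)) \<in> I"
        using \<phi> by (simp add: Vector_Spaces.linear_iff vs2.scale_left_distrib vs2.subspace_0[OF I])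
    next
      fix m n n' assume n: "n \<in> elems ?N" "n' \<in> elems ?N"
      have "s2 (\<phi> m) (rep (madd ?N n n') - (rep n + rep n')) \<in> I"
        using n by (intro vs2.subspace_scale[OF I] vs2.rep_madd_quot_mod[OF I]) (simp_all add: vs2.elems_quot_mod)
      then show "lin_ext s2 ?f (frag_of (m, madd ?N n n')) - lin_ext s2 ?f (frag_of (m, n)) -
          lin_ext s2 ?f (frag_of (m, n')) \<in> I"
        by (simp add: vs2.scale_right_diff_distrib vs2.scale_right_distrib diff_diff_eq)
    next
      fix c m n
      have "s2 (\<phi> m) (rep (mact ?N c n) - s2 c (rep n)) \<in> I"
        by (intro vs2.subspace_scale[OF I] vs2.rep_mact_quot_mod[OF I])
      from diff_closedD(3)[OF Ic this]
      show "lin_ext s2 ?f (frag_of (mact (vs s1) c m, n)) - lin_ext s2 ?f (frag_of (m, mact ?N c n)) \<in> I"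
        using \<phi> by (simp add: Vector_Spaces.linear_iff vs2.scale_right_diff_distrib mult.commute)
    qed
  qed
  show ?l if r: ?r
  proof -
    let ?P = "frag_extend (\<lambda>(x, y). frag_of (x, proj (quot I) y))"
    let ?R = "frag_extend (\<lambda>(x, X). frag_of (x, rep X))"
    note PR = project_lift[OF I Z]
    have "\<forall>\<phi>. Vector_Spaces.linear s1 (*) \<phi> \<longrightarrow> lin_ext s2 (\<lambda>(x, y). s2 (\<phi> x) y) (?R Z) \<in> I"
      using r by (simp add: vs2.lin_ext_frag_extend split_def)
    then obtain t' where t': "Poly_Mapping.keys t' \<subseteq> UNIV \<times> I" "?R Z - t' \<in> trel"
      using tensor_right[of "?R Z" I] by auto
    have proj_mem: "proj (quot I) y \<in> elems ?N" for y
      by (simp add: vs2.elems_quot_mod vs2.proj_in_quot[OF I])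
    have "?P (?R Z - t') \<in> tensor_rel UNIV (vs s1) ?N"
    proof (rule additive_tensor_rel[OF additive_frag_extend rc t'(2)])
      fix m m' n
      show "?P (frag_of (madd (vs s1) m m', n)) - ?P (frag_of (m, n)) - ?P (frag_of (m', n)) \<in> tensor_rel UNIV (vs s1) ?N"
        using tensor_rel.add_left[where M = "vs s1" and N = ?N, of m m' "proj (quot I) n"] proj_mem by simp
    next
      fix m n n'
      show "?P (frag_of (m, madd (vs s2) n n')) - ?P (frag_of (m, n)) - ?P (frag_of (m, n')) \<in> tensor_rel UNIV (vs s1) ?N"
        using tensor_rel.add_right[where M = "vs s1" and N = ?N, of m "proj (quot I) n" "proj (quot I) n'"] proj_mem
        by (simp add: vs2.madd_quot_mod[OF I])
    next
      fix c m n
      show "?P (frag_of (mact (vs s1) c m, n)) - ?P (frag_of (m, mact (vs s2) c n)) \<in> tensor_rel UNIV (vs s1) ?N"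
        using tensor_rel.balanced[where M = "vs s1" and N = ?N, of c UNIV m "proj (quot I) n"] proj_mem
        by (simp add: vs2.mact_quot_mod[OF I])
    qed
    moreover have "?P t' \<in> tensor_rel UNIV (vs s1) ?N"
    proof (rule additive_frag_in[OF additive_frag_extend rc t'(1)])
      fix p :: "'m \<times> 'n" assume "p \<in> UNIV \<times> I"
      then obtain x y where p: "p = (x, y)" "y \<in> I" by auto
      have "proj (quot I) y = proj (quot I) 0" using p(2) by (simp add: vs2.proj_quot_eq_iff[OF I])
      moreover have "frag_of (x, proj (quot I) 0) \<in> tensor_rel UNIV (vs s1) ?N"
        using diff_closedD(3)[OF rc tensor_rel.add_right[where M = "vs s1" and N = ?N,
              of x "proj (quot I) 0" "proj (quot I) 0"]] proj_mem
        by (simp add: vs2.madd_quot_mod[OF I])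
      ultimately show "?P (frag_of p) \<in> tensor_rel UNIV (vs s1) ?N" by (simp add: p(1))
    qed
    ultimately show ?l
      using diff_closed_cong[OF rc, of Z "?P t'"] unfolding frag_extend_diff PR by simp
  qed
qed

lemma rep_proj_lin_ext:
  assumes I: "vs2.subspace I"
  shows "lin_ext s2 (\<lambda>p. s2 (f p) (rep (proj (quot I) (g p)))) t - lin_ext s2 (\<lambda>p. s2 (f p) (g p)) t \<in> I"
  unfolding vs2.lin_ext_minus[symmetric]
  by (rule vs2.lin_ext_in[OF I])
    (simp add: vs2.scale_right_diff_distrib[symmetric] vs2.subspace_scale[OF I] vs2.rep_proj[OF I])

lemma projected_tensor_zero_iff:
  assumes I: "vs2.subspace I"
  shows "frag_extend (\<lambda>(x, y). frag_of (x, proj (quot I) y)) t \<in> tensor_rel UNIV (vs s1) (quot_mod s2 (quot I)) \<longleftrightarrow>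
    (\<forall>\<phi>. Vector_Spaces.linear s1 (*) \<phi> \<longrightarrow> lin_ext s2 (\<lambda>(x, y). s2 (\<phi> x) y) t \<in> I)"
proof -
  have k: "Poly_Mapping.keys (frag_extend (\<lambda>(x, y). frag_of (x, proj (quot I) y)) t) \<subseteq> UNIV \<times> quot I"
    by (rule order.trans[OF keys_frag_extend]) (auto simp: vs2.proj_in_quot[OF I])
  have "lin_ext s2 (\<lambda>(x, X). s2 (\<phi> x) (rep X)) (frag_extend (\<lambda>(x, y). frag_of (x, proj (quot I) y)) t) \<in> I \<longleftrightarrow>
      lin_ext s2 (\<lambda>(x, y). s2 (\<phi> x) y) t \<in> I" for \<phi>
    using diff_closed_cong[OF vs2.diff_closed_subspace[OF I] rep_proj_lin_ext[OF I, of "\<lambda>p. \<phi> (fst p)" snd t]]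
    by (simp add: vs2.lin_ext_frag_extend split_def)
  then show ?thesis unfolding quotient_tensor_zero_iff[OF I k] by simp
qed

end

section \<open>Slices and coinvariants\<close>

text \<open>
  \<open>(\<phi> \<otimes> id)(\<rho> m) = \<Sum> \<phi>(m\<^sub>0) m\<^sub>1\<close>. Since functionals separate tensors, the coaction is determined by its
  slices, and conditions on \<open>\<rho> m\<close> become conditions on elements of \<open>H\<close>.
\<close>

definition slice ::
  "('k::field \<Rightarrow> 'h::ab_group_add \<Rightarrow> 'h) \<Rightarrow> ('m \<Rightarrow> ('m \<times> 'h \<Rightarrow>\<^sub>0 int) set) \<Rightarrow> ('m \<Rightarrow> 'k) \<Rightarrow> 'm \<Rightarrow> 'h"
  where "slice s \<rho> \<phi> m = tensor_eval s (\<lambda>x y. s (\<phi> x) y) (\<rho> m)"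

context comodule_algebra begin

lemma linear_scaled_functional:
  "Vector_Spaces.linear scaleH (*) \<chi> \<Longrightarrow> Vector_Spaces.linear scaleH scaleH (\<lambda>z. scaleH (\<chi> z) w)"
  using vector_space_axioms by (simp add: Vector_Spaces.linear_iff scale_left_distrib)

lemma linear_slice:
  assumes "Vector_Spaces.linear scaleA (*) \<phi>"
  shows "Vector_Spaces.linear scaleA scaleH (slice scaleH \<delta> \<phi>)"
  using linear_coaction_eval[OF AH.bilinear_functional[OF assms]]
  by (simp add: slice_def[abs_def])

lemma trilinear_functionals:
  assumes \<phi>: "Vector_Spaces.linear scaleA (*) \<phi>" and \<chi>: "Vector_Spaces.linear scaleH (*) \<chi>"
  shows "trilinear scaleA scaleH scaleH scaleH (\<lambda>y v w. scaleH (\<phi> y * \<chi> v) w)"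
proof -
  have e: "\<phi> (x + y) = \<phi> x + \<phi> y" "\<phi> (scaleA c x) = c * \<phi> x" "\<chi> (u + v) = \<chi> u + \<chi> v" "\<chi> (scaleH c u) = c * \<chi> u"
    for x y c u v using \<phi> \<chi> by (simp_all add: Vector_Spaces.linear_iff)
  show ?thesis
    using vector_space_axioms A.vector_space_axioms
    by (simp add: trilinear_def bilinear_def Vector_Spaces.linear_iff e scale_left_distrib
        scale_right_distrib mult_ac distrib_left distrib_right)
qed

text \<open>
  Coassociativity, seen through slices.
\<close>

lemma slice_slice:
  assumes \<phi>: "Vector_Spaces.linear scaleA (*) \<phi>" and \<chi>: "Vector_Spaces.linear scaleH (*) \<chi>"
  shows "slice scaleH \<Delta> \<chi> (slice scaleH \<delta> \<phi> a) = slice scaleH \<delta> (\<lambda>x. \<chi> (slice scaleH \<delta> \<phi> x)) a"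
proof -
  have lin: "Vector_Spaces.linear scaleH scaleH (slice scaleH \<Delta> \<chi>)"
    by (rule comodule_algebra.linear_slice[OF regular \<chi>])
  note co = coaction_eval_coassoc[OF trilinear_functionals[OF \<phi> \<chi>], of a]
  have "slice scaleH \<Delta> \<chi> (slice scaleH \<delta> \<phi> a) =
      tensor_eval scaleH (\<lambda>x w. slice scaleH \<Delta> \<chi> (scaleH (\<phi> x) w)) (\<delta> a)"
    unfolding slice_def[of _ \<delta>] by (rule linear_tensor_eval[OF lin])
  also have "\<dots> = tensor_eval scaleH (\<lambda>x w. tensor_eval scaleH (\<lambda>u v. scaleH (\<phi> x * \<chi> u) v) (\<Delta> w)) (\<delta> a)"
    using lin by (simp add: Vector_Spaces.linear_iff slice_def tensor_eval_scale[symmetric])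
  also have "\<dots> = slice scaleH \<delta> (\<lambda>x. \<chi> (slice scaleH \<delta> \<phi> x)) a"
    unfolding co[symmetric] slice_def linear_tensor_eval[OF linear_scaled_functional[OF \<chi>]]
    using \<chi> by (simp add: Vector_Spaces.linear_iff)
  finally show ?thesis .
qed

lemma counit_slice:
  assumes \<phi>: "Vector_Spaces.linear scaleA (*) \<phi>"
  shows "\<epsilon> (slice scaleH \<delta> \<phi> a) = \<phi> a"
proof -
  have "\<epsilon> (slice scaleH \<delta> \<phi> a) = tensor_eval (*) (\<lambda>x y. \<phi> x * \<epsilon> y) (\<delta> a)"
    unfolding slice_def linear_tensor_eval[OF counit_linear]
    using counit_linear by (simp add: Vector_Spaces.linear_iff)
  also have "\<dots> = \<phi> (tensor_eval scaleA (\<lambda>x y. scaleA (\<epsilon> y) x) (\<delta> a))"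
    unfolding A.linear_tensor_eval[OF \<phi>]
    using \<phi> by (simp add: Vector_Spaces.linear_iff mult.commute)
  finally show ?thesis by (simp only: coaction_counit)
qed

lemma linear_mult_functional:
  assumes "Vector_Spaces.linear scaleA (*) \<phi>"
  shows "Vector_Spaces.linear scaleA (*) (\<lambda>x. \<phi> (x * y))" "Vector_Spaces.linear scaleA (*) (\<lambda>x. \<phi> (y * x))"
  using assms by (simp_all add: Vector_Spaces.linear_iff distrib_left distrib_right
      A.scale_mult_left A.scale_mult_right)

lemma slice_mult:
  assumes \<phi>: "Vector_Spaces.linear scaleA (*) \<phi>"
  shows "slice scaleH \<delta> \<phi> (a * b) = tensor_eval scaleH (\<lambda>y v. slice scaleH \<delta> (\<lambda>x. \<phi> (x * y)) a * v) (\<delta> b)"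
proof -
  have lin: "Vector_Spaces.linear scaleH scaleH (\<lambda>u. u * v)" for v
    using vector_space_axioms by (simp add: Vector_Spaces.linear_iff distrib_right scale_mult_left)
  have "slice scaleH \<delta> \<phi> (a * b) =
      tensor_eval scaleH (\<lambda>x u. tensor_eval scaleH (\<lambda>y v. scaleH (\<phi> (x * y)) u * v) (\<delta> b)) (\<delta> a)"
    unfolding slice_def coaction_eval_mult[OF AH.bilinear_functional[OF \<phi>]]
    by (simp add: scale_mult_left)
  also have "\<dots> = tensor_eval scaleH (\<lambda>y v. tensor_eval scaleH (\<lambda>x u. scaleH (\<phi> (x * y)) u * v) (\<delta> a)) (\<delta> b)"
    by (rule tensor_eval_swap)
  finally show ?thesis
    unfolding slice_def linear_tensor_eval[OF lin] .
qed

text \<open>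
  The difference vanishes when \<open>a\<close> is coinvariant, and lies in a right ideal \<open>I\<close> when \<open>a\<close> is coinvariant
  modulo \<open>I\<close>: each summand then has its left factor in \<open>I\<close>. This one identity yields that coinvariants
  form an algebra, that \<open>K\<^sup>+H\<close> is a coideal, and that the canonical map is balanced.
\<close>

lemma slice_mult_diff:
  assumes \<phi>: "Vector_Spaces.linear scaleA (*) \<phi>"
  shows "slice scaleH \<delta> \<phi> (a * b) - slice scaleH \<delta> (\<lambda>y. \<phi> (a * y)) b =
    tensor_eval scaleH (\<lambda>y v. (slice scaleH \<delta> (\<lambda>x. \<phi> (x * y)) a - scaleH (\<phi> (a * y)) 1) * v) (\<delta> b)"
proof -
  have "slice scaleH \<delta> (\<lambda>y. \<phi> (a * y)) b = tensor_eval scaleH (\<lambda>y v. scaleH (\<phi> (a * y)) 1 * v) (\<delta> b)"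
    unfolding slice_def by (simp add: scale_mult_left)
  then show ?thesis
    unfolding slice_mult[OF \<phi>] by (simp only: tensor_eval_minus[symmetric] left_diff_distrib)
qed

lemma coinvariants_iff:
  assumes I: "subspace I"
  shows "a \<in> coinvariants scaleH scaleA \<delta> (quot I) \<longleftrightarrow>
    (\<forall>\<phi>. Vector_Spaces.linear scaleA (*) \<phi> \<longrightarrow> slice scaleH \<delta> \<phi> a - scaleH (\<phi> a) 1 \<in> I)"
proof -
  let ?P = "frag_extend (\<lambda>(x, y). frag_of (x, proj (quot I) y))"
  have "a \<in> coinvariants scaleH scaleA \<delta> (quot I) \<longleftrightarrow>
      ?P (rep (\<delta> a) - frag_of (a, 1)) \<in> tensor_rel UNIV (vs scaleA) (quot_mod scaleH (quot I))"
    by (simp add: coinvariants_def tensor_map_def tensor_lift_def pure_tensor_def tensor_class_eq_iff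
        frag_extend_diff)
  then show ?thesis
    unfolding AH.projected_tensor_zero_iff[OF I]
    by (simp add: slice_def tensor_eval_lin_ext lin_ext_diff)
qed

lemma full_coinvariants_slice:
  assumes "a \<in> full_coinvariants scaleH scaleA \<delta>" "Vector_Spaces.linear scaleA (*) \<phi>"
  shows "slice scaleH \<delta> \<phi> a = scaleH (\<phi> a) 1"
  using assms(1) tensor_eval_pure[OF AH.bilinear_functional[OF assms(2)]]
  by (simp add: full_coinvariants_def slice_def)

lemma slice_one:
  assumes "Vector_Spaces.linear scaleA (*) \<phi>"
  shows "slice scaleH \<delta> \<phi> 1 = scaleH (\<phi> 1) 1"
  unfolding slice_def by (rule coaction_eval_one[OF AH.bilinear_functional[OF assms]])

lemma subalgebra_coinvariants:
  assumes I: "subspace I" and rI: "\<forall>x\<in>I. \<forall>h. x * h \<in> I"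
  shows "subalgebra scaleA (coinvariants scaleH scaleA \<delta> (quot I))"
proof -
  let ?S = "coinvariants scaleH scaleA \<delta> (quot I)"
  note iff = coinvariants_iff[OF I]
  note Ic = diff_closed_subspace[OF I]
  have "A.subspace ?S"
  proof (rule A.subspaceI)
    show "0 \<in> ?S"
      unfolding iff
    proof (intro allI impI)
      fix \<phi> assume \<phi>: "Vector_Spaces.linear scaleA (*) \<phi>"
      show "slice scaleH \<delta> \<phi> 0 - scaleH (\<phi> 0) 1 \<in> I"
        by (simp add: linear_zero[OF \<phi>] linear_zero[OF linear_slice[OF \<phi>]] subspace_0[OF I])
    qed
  next
    fix x y assume xy: "x \<in> ?S" "y \<in> ?S"
    show "x + y \<in> ?S"
      unfolding iff
    proof (intro allI impI)
      fix \<phi> assume \<phi>: "Vector_Spaces.linear scaleA (*) \<phi>"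
      have "slice scaleH \<delta> \<phi> (x + y) - scaleH (\<phi> (x + y)) 1 =
          (slice scaleH \<delta> \<phi> x - scaleH (\<phi> x) 1) + (slice scaleH \<delta> \<phi> y - scaleH (\<phi> y) 1)"
        using \<phi> linear_slice[OF \<phi>] by (simp add: Vector_Spaces.linear_iff scale_left_distrib)
      then show "slice scaleH \<delta> \<phi> (x + y) - scaleH (\<phi> (x + y)) 1 \<in> I"
        using xy \<phi> unfolding iff by (simp add: subspace_add[OF I])
    qed
  next
    fix c x assume x: "x \<in> ?S"
    show "scaleA c x \<in> ?S"
      unfolding iff
    proof (intro allI impI)
      fix \<phi> assume \<phi>: "Vector_Spaces.linear scaleA (*) \<phi>"
      have "slice scaleH \<delta> \<phi> (scaleA c x) - scaleH (\<phi> (scaleA c x)) 1 =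
          scaleH c (slice scaleH \<delta> \<phi> x - scaleH (\<phi> x) 1)"
        using \<phi> linear_slice[OF \<phi>] by (simp add: Vector_Spaces.linear_iff scale_right_diff_distrib)
      then show "slice scaleH \<delta> \<phi> (scaleA c x) - scaleH (\<phi> (scaleA c x)) 1 \<in> I"
        using x \<phi> unfolding iff by (simp add: subspace_scale[OF I])
    qed
  qed
  moreover have "1 \<in> ?S"
    unfolding iff by (simp add: slice_one subspace_0[OF I])
  moreover have "a * b \<in> ?S" if a: "a \<in> ?S" and b: "b \<in> ?S" for a b
    unfolding iff
  proof (intro allI impI)
    fix \<phi> assume \<phi>: "Vector_Spaces.linear scaleA (*) \<phi>"
    have "slice scaleH \<delta> \<phi> (a * b) - slice scaleH \<delta> (\<lambda>y. \<phi> (a * y)) b \<in> I"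
      unfolding slice_mult_diff[OF \<phi>]
      by (intro tensor_eval_in[OF I] rI[rule_format]
          a[unfolded iff, rule_format, OF linear_mult_functional(1)[OF \<phi>]])
    moreover have "slice scaleH \<delta> (\<lambda>y. \<phi> (a * y)) b - scaleH (\<phi> (a * b)) 1 \<in> I"
      by (rule b[unfolded iff, rule_format, OF linear_mult_functional(2)[OF \<phi>]])
    ultimately show "slice scaleH \<delta> \<phi> (a * b) - scaleH (\<phi> (a * b)) 1 \<in> I"
      by (rule diff_closed_trans[OF Ic])
  qed
  ultimately show ?thesis by (simp add: subalgebra_def)
qed

text \<open>
  The coaction maps \<open>A\<^sup>c\<^sup>o\<^sup>Q\<close> into \<open>A \<otimes> H\<^sup>c\<^sup>o\<^sup>Q\<close>: slicing the slice of \<open>a\<close> once more is slicing \<open>a\<close> by a different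
  functional, to which the coinvariance of \<open>a\<close> applies. With \<open>A = H\<close> it shows that \<open>H\<^sup>c\<^sup>o\<^sup>Q\<close> is a left coideal.
\<close>

lemma slice_coinvariant:
  assumes I: "subspace I" and a: "a \<in> coinvariants scaleH scaleA \<delta> (quot I)"
    and \<phi>: "Vector_Spaces.linear scaleA (*) \<phi>"
  shows "slice scaleH \<delta> \<phi> a \<in> coinvariants scaleH scaleH \<Delta> (quot I)"
  unfolding comodule_algebra.coinvariants_iff[OF regular I]
proof (intro allI impI)
  fix \<chi> assume \<chi>: "Vector_Spaces.linear scaleH (*) \<chi>"
  have lin: "Vector_Spaces.linear scaleA (*) (\<lambda>x. \<chi> (slice scaleH \<delta> \<phi> x))"
    using linear_slice[OF \<phi>] \<chi> by (simp add: Vector_Spaces.linear_iff)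
  show "slice scaleH \<Delta> \<chi> (slice scaleH \<delta> \<phi> a) - scaleH (\<chi> (slice scaleH \<delta> \<phi> a)) 1 \<in> I"
    unfolding slice_slice[OF \<phi> \<chi>] by (rule a[unfolded coinvariants_iff[OF I], rule_format, OF lin])
qed

end

section \<open>Generalised quotients and left coideal subalgebras\<close>

context hopf_algebra begin

lemma comult_class: "tensor_class UNIV (vs scaleH) (vs scaleH) (rep (\<Delta> h)) = \<Delta> h"
  by (rule tensor_class_rep[OF comodule_algebra.coaction_carrier[OF regular]])

lemma slice_lin_ext: "slice scaleH \<Delta> \<phi> h = lin_ext scaleH (\<lambda>(x, y). scaleH (\<phi> x) y) (rep (\<Delta> h))"
  by (simp add: slice_def tensor_eval_lin_ext)

lemma slice_counit: "slice scaleH \<Delta> \<epsilon> h = h"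
  by (simp add: slice_def counit_left)

lemma right_ideal_coideal_iff:
  "right_ideal_coideal scaleH \<Delta> \<epsilon> I \<longleftrightarrow>
    subspace I \<and> (\<forall>x\<in>I. \<forall>h. x * h \<in> I) \<and>
    (\<forall>x\<in>I. \<forall>\<phi>. Vector_Spaces.linear scaleH (*) \<phi> \<longrightarrow> (\<forall>y\<in>I. \<phi> y = 0) \<longrightarrow> slice scaleH \<Delta> \<phi> x \<in> I) \<and>
    (\<forall>x\<in>I. \<epsilon> x = 0)"
proof (cases "subspace I")
  case True
  show ?thesis
    unfolding right_ideal_coideal_def slice_lin_ext
    using HH.tensor_split_iff[OF True True, of "rep (\<Delta> _)"] unfolding comult_class by simp
qed (simp add: right_ideal_coideal_def)

lemma Sub_gen_iff:
  "K \<in> Sub_gen scaleH \<Delta> \<longleftrightarrow> subalgebra scaleH K \<and>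
    (\<forall>x\<in>K. \<forall>\<phi>. Vector_Spaces.linear scaleH (*) \<phi> \<longrightarrow> slice scaleH \<Delta> \<phi> x \<in> K)"
proof (cases "subspace K")
  case True
  show ?thesis
    unfolding Sub_gen_def slice_lin_ext
    using HH.tensor_right_iff[OF True, of "rep (\<Delta> _)"] unfolding comult_class by simp
qed (simp add: Sub_gen_def subalgebra_def)

lemma plus_ideal_generator: "x \<in> K \<Longrightarrow> \<epsilon> x = 0 \<Longrightarrow> x * h \<in> plus_ideal scaleH \<epsilon> K"
  unfolding plus_ideal_def by (intro span_base) blast

lemma plus_ideal_subset:
  assumes "subspace S" "\<And>x h. x \<in> K \<Longrightarrow> \<epsilon> x = 0 \<Longrightarrow> x * h \<in> S"
  shows "plus_ideal scaleH \<epsilon> K \<subseteq> S"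
  unfolding plus_ideal_def by (rule span_minimal[OF _ assms(1)]) (use assms(2) in blast)

lemma subspace_plus_ideal: "subspace (plus_ideal scaleH \<epsilon> K)"
  unfolding plus_ideal_def by (rule subspace_span)

lemma plus_ideal_right_ideal:
  assumes "y \<in> plus_ideal scaleH \<epsilon> K"
  shows "y * h \<in> plus_ideal scaleH \<epsilon> K"
proof -
  let ?S = "{y. \<forall>h. y * h \<in> plus_ideal scaleH \<epsilon> K}"
  have "subspace ?S"
    by (rule subspaceI) (auto simp: distrib_right scale_mult_left subspace_0[OF subspace_plus_ideal]
        subspace_add[OF subspace_plus_ideal] subspace_scale[OF subspace_plus_ideal])
  moreover have "x * g \<in> ?S" if "x \<in> K" "\<epsilon> x = 0" for x g
    using plus_ideal_generator[OF that] by (simp add: mult.assoc)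
  ultimately have "plus_ideal scaleH \<epsilon> K \<subseteq> ?S" by (rule plus_ideal_subset)
  then show ?thesis using assms by blast
qed

lemma counit_plus_ideal:
  assumes "y \<in> plus_ideal scaleH \<epsilon> K"
  shows "\<epsilon> y = 0"
proof -
  have "subspace {y. \<epsilon> y = 0}"
    using counit_linear linear_zero[OF counit_linear] by (auto intro!: subspaceI simp: Vector_Spaces.linear_iff)
  then have "plus_ideal scaleH \<epsilon> K \<subseteq> {y. \<epsilon> y = 0}"
    by (rule plus_ideal_subset) (simp add: counit_mult)
  then show ?thesis using assms by blast
qed

lemma minus_counit_mult_in_plus_ideal:
  assumes K: "subalgebra scaleH K" and x: "x \<in> K"
  shows "(x - scaleH (\<epsilon> x) 1) * h \<in> plus_ideal scaleH \<epsilon> K"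
proof (rule plus_ideal_generator)
  show "x - scaleH (\<epsilon> x) 1 \<in> K"
    using K x by (simp add: subalgebra_def subspace_diff subspace_scale)
  show "\<epsilon> (x - scaleH (\<epsilon> x) 1) = 0"
    using counit_linear additive.diff[of \<epsilon> x "scaleH (\<epsilon> x) 1"]
    by (simp add: Vector_Spaces.linear_iff additive_def counit_one)
qed

lemma slice_minus_in_plus_ideal:
  assumes K: "K \<in> Sub_gen scaleH \<Delta>" and x: "x \<in> K" and \<phi>: "Vector_Spaces.linear scaleH (*) \<phi>"
  shows "(slice scaleH \<Delta> \<phi> x - scaleH (\<phi> x) 1) * h \<in> plus_ideal scaleH \<epsilon> K"
  using minus_counit_mult_in_plus_ideal[of K "slice scaleH \<Delta> \<phi> x" h] K x \<phi>
  unfolding comodule_algebra.counit_slice[OF regular \<phi>] Sub_gen_iff by blast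

text \<open>
  For the coideal condition take \<open>\<phi>\<close> vanishing on \<open>K\<^sup>+H\<close> and a generator \<open>x h\<close> with \<open>x \<in> K\<^sup>+\<close>. The functional
  \<open>\<phi>(x \<cdot>)\<close> is zero, so the slice of \<open>x h\<close> is the right-hand side of the product identity for slices,
  where each left factor is \<open>k - \<epsilon>(k) 1\<close> for a slice \<open>k \<in> K\<close> of \<open>x\<close>.
\<close>

lemma right_ideal_coideal_plus_ideal:
  assumes K: "K \<in> Sub_gen scaleH \<Delta>"
  shows "right_ideal_coideal scaleH \<Delta> \<epsilon> (plus_ideal scaleH \<epsilon> K)"
proof -
  let ?I = "plus_ideal scaleH \<epsilon> K"
  have "slice scaleH \<Delta> \<phi> y \<in> ?I"
    if y: "y \<in> ?I" and \<phi>: "Vector_Spaces.linear scaleH (*) \<phi>" and \<phi>I: "\<forall>y\<in>?I. \<phi> y = 0" for y \<phi>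
  proof -
    note lin = comodule_algebra.linear_slice[OF regular \<phi>]
    have "subspace {y. slice scaleH \<Delta> \<phi> y \<in> ?I}"
      using lin linear_zero[OF lin]
      by (auto intro!: subspaceI simp: Vector_Spaces.linear_iff subspace_0[OF subspace_plus_ideal]
        subspace_add[OF subspace_plus_ideal] subspace_scale[OF subspace_plus_ideal])
    moreover have "x * h \<in> {y. slice scaleH \<Delta> \<phi> y \<in> ?I}" if x: "x \<in> K" "\<epsilon> x = 0" for x h
    proof -
      have "\<phi> (x * y) = 0" for y using \<phi>I plus_ideal_generator[OF x] by blast
      then have "slice scaleH \<Delta> (\<lambda>y. \<phi> (x * y)) h = 0"
        by (simp add: slice_def tensor_eval_def split_def)
      then have "slice scaleH \<Delta> \<phi> (x * h) =
          tensor_eval scaleH (\<lambda>y v. (slice scaleH \<Delta> (\<lambda>z. \<phi> (z * y)) x - scaleH (\<phi> (x * y)) 1) * v) (\<Delta> h)"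
        using comodule_algebra.slice_mult_diff[OF regular \<phi>, of x h] by simp
      also have "\<dots> \<in> ?I"
        by (intro tensor_eval_in[OF subspace_plus_ideal] slice_minus_in_plus_ideal[OF K x(1)]
            comodule_algebra.linear_mult_functional(1)[OF regular \<phi>])
      finally show ?thesis by simp
    qed
    ultimately have "?I \<subseteq> {y. slice scaleH \<Delta> \<phi> y \<in> ?I}" by (rule plus_ideal_subset)
    then show ?thesis using y by blast
  qed
  then show ?thesis
    unfolding right_ideal_coideal_iff
    using subspace_plus_ideal plus_ideal_right_ideal counit_plus_ideal by blast
qed

lemma coinvariants_Sub_gen:
  assumes I: "subspace I" and rI: "\<forall>x\<in>I. \<forall>h. x * h \<in> I"
  shows "coinvariants scaleH scaleH \<Delta> (quot I) \<in> Sub_gen scaleH \<Delta>"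
  unfolding Sub_gen_iff
  using comodule_algebra.subalgebra_coinvariants[OF regular I rI]
    comodule_algebra.slice_coinvariant[OF regular I] by simp

text \<open>
  Slicing by \<open>\<epsilon>\<close> returns the element, so coinvariance of \<open>x \<in> ker \<epsilon>\<close> tested with \<open>\<epsilon>\<close> says \<open>x \<in> I\<close>.
\<close>

lemma plus_ideal_coinvariants_subset:
  assumes I: "subspace I" and rI: "\<forall>x\<in>I. \<forall>h. x * h \<in> I"
  shows "plus_ideal scaleH \<epsilon> (coinvariants scaleH scaleH \<Delta> (quot I)) \<subseteq> I"
proof (rule plus_ideal_subset[OF I])
  fix x h assume x: "x \<in> coinvariants scaleH scaleH \<Delta> (quot I)" "\<epsilon> x = 0"
  have "slice scaleH \<Delta> \<epsilon> x - scaleH (\<epsilon> x) 1 \<in> I"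
    using x(1) counit_linear unfolding comodule_algebra.coinvariants_iff[OF regular I] by blast
  then show "x * h \<in> I" using rI x(2) by (simp add: slice_counit)
qed

lemma Quot_gen_le_iff:
  assumes "right_ideal_coideal scaleH \<Delta> \<epsilon> I" "right_ideal_coideal scaleH \<Delta> \<epsilon> J"
  shows "quot J \<sqsubseteq>\<^bsub>Quot_gen scaleH \<Delta> \<epsilon>\<^esub> quot I \<longleftrightarrow> I \<subseteq> J"
proof -
  let ?ric = "right_ideal_coideal scaleH \<Delta> \<epsilon>"
  have sub: "subspace J" if "?ric J" for J
    using that by (simp add: right_ideal_coideal_def)
  have "quot J \<sqsubseteq>\<^bsub>Quot_gen scaleH \<Delta> \<epsilon>\<^esub> quot I \<longleftrightarrow>
      (\<exists>I' J'. ?ric I' \<and> ?ric J' \<and> quot I = quot I' \<and> quot J = quot J' \<and> I' \<subseteq> J')"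
    by (simp add: Quot_gen_def)
  also have "\<dots> \<longleftrightarrow> I \<subseteq> J"
    using assms quot_inject[OF sub sub] by metis
  finally show ?thesis .
qed

text \<open>
  A functional vanishing on a sum of coideals vanishes on each of them, so the slice criterion passes
  to sums. This provides the joins of generalised quotients.
\<close>

lemma right_ideal_coideal_sum:
  assumes "\<And>J. J \<in> \<J> \<Longrightarrow> right_ideal_coideal scaleH \<Delta> \<epsilon> J"
  shows "right_ideal_coideal scaleH \<Delta> \<epsilon> (span (\<Union>\<J>))"
proof -
  let ?U = "span (\<Union>\<J>)"
  have J: "J \<subseteq> ?U" if "J \<in> \<J>" for J using that span_superset[of "\<Union>\<J>"] by blast
  have ric: "subspace J" "\<And>x h. x \<in> J \<Longrightarrow> x * h \<in> J" "\<And>x. x \<in> J \<Longrightarrow> \<epsilon> x = 0"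
    "\<And>x \<phi>. x \<in> J \<Longrightarrow> Vector_Spaces.linear scaleH (*) \<phi> \<Longrightarrow> (\<forall>y\<in>J. \<phi> y = 0) \<Longrightarrow> slice scaleH \<Delta> \<phi> x \<in> J"
    if "J \<in> \<J>" for J
    using assms[OF that] unfolding right_ideal_coideal_iff by blast+
  have "x * h \<in> ?U" if "x \<in> ?U" for x h
  proof -
    have "subspace {x. x * h \<in> ?U}"
      by (rule subspaceI) (auto simp: distrib_right scale_mult_left span_zero span_add span_scale)
    moreover have "\<Union>\<J> \<subseteq> {x. x * h \<in> ?U}" using J ric(2) by blast
    ultimately show ?thesis using that span_minimal by blast
  qed
  moreover have "\<epsilon> x = 0" if "x \<in> ?U" for x
  proof -
    have "subspace {y. \<epsilon> y = 0}"
      using counit_linear linear_zero[OF counit_linear] by (auto intro!: subspaceI simp: Vector_Spaces.linear_iff)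
    moreover have "\<Union>\<J> \<subseteq> {y. \<epsilon> y = 0}" using ric(3) by blast
    ultimately show ?thesis using that span_minimal by blast
  qed
  moreover have "slice scaleH \<Delta> \<phi> x \<in> ?U"
    if "x \<in> ?U" and \<phi>: "Vector_Spaces.linear scaleH (*) \<phi>" and \<phi>U: "\<forall>y\<in>?U. \<phi> y = 0" for x \<phi>
  proof -
    note lin = comodule_algebra.linear_slice[OF regular \<phi>]
    have "subspace {y. slice scaleH \<Delta> \<phi> y \<in> ?U}"
      using lin linear_zero[OF lin]
      by (auto intro!: subspaceI simp: Vector_Spaces.linear_iff span_zero span_add span_scale)
    moreover have "\<Union>\<J> \<subseteq> {y. slice scaleH \<Delta> \<phi> y \<in> ?U}" using J ric(4) \<phi> \<phi>U by blast
    ultimately show ?thesis using that(1) span_minimal by blast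
  qed
  ultimately show ?thesis unfolding right_ideal_coideal_iff by simp
qed

text \<open>
  The join of the \<open>H/I\<close> is \<open>H/U\<close>, where \<open>U\<close> is the sum of all right ideal coideals contained in every \<open>I\<close>. Since
  \<open>\<Squnion>\<close> is a choice among least upper bounds, existence of one makes it a least upper bound.
\<close>

lemma Quot_gen_join_least:
  assumes F: "F \<subseteq> carrier (Quot_gen scaleH \<Delta> \<epsilon>)"
  shows "least (Quot_gen scaleH \<Delta> \<epsilon>) (\<Squnion>\<^bsub>Quot_gen scaleH \<Delta> \<epsilon>\<^esub> F) (Upper (Quot_gen scaleH \<Delta> \<epsilon>) F)"
proof -
  let ?L = "Quot_gen scaleH \<Delta> \<epsilon>" and ?ric = "right_ideal_coideal scaleH \<Delta> \<epsilon>"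
  have carrier: "Q \<in> carrier ?L \<longleftrightarrow> (\<exists>I. ?ric I \<and> Q = quot I)" for Q
    by (auto simp: Quot_gen_def)
  define \<J> where "\<J> = {J. ?ric J \<and> quot J \<in> Upper ?L F}"
  have U: "?ric (span (\<Union>\<J>))" by (rule right_ideal_coideal_sum) (simp add: \<J>_def)
  have "least ?L (quot (span (\<Union>\<J>))) (Upper ?L F)"
  proof (rule least_UpperI)
    fix Q assume Q: "Q \<in> F"
    then obtain I where I: "?ric I" "Q = quot I" using F carrier by blast
    have "J \<subseteq> I" if "J \<in> \<J>" for J
      using that Q F I Quot_gen_le_iff[of J I] unfolding \<J>_def Upper_def by auto
    then have "span (\<Union>\<J>) \<subseteq> I"
      using I(1) by (intro span_minimal) (auto simp: right_ideal_coideal_def)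
    then show "Q \<sqsubseteq>\<^bsub>?L\<^esub> quot (span (\<Union>\<J>))"
      using Quot_gen_le_iff[OF U I(1)] I(2) by simp
  next
    fix Q assume Q: "Q \<in> Upper ?L F"
    then obtain J where J: "?ric J" "Q = quot J" using carrier by (auto simp: Upper_def)
    then have "J \<in> \<J>" using Q by (simp add: \<J>_def)
    then have "J \<subseteq> span (\<Union>\<J>)" using span_superset[of "\<Union>\<J>"] by blast
    then show "quot (span (\<Union>\<J>)) \<sqsubseteq>\<^bsub>?L\<^esub> Q"
      using Quot_gen_le_iff[OF J(1) U] J(2) by simp
  next
    show "F \<subseteq> carrier ?L" by (rule F)
    show "quot (span (\<Union>\<J>)) \<in> carrier ?L" using U carrier by blast
  qed
  then show ?thesis unfolding sup_def by (rule someI)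
qed

end

context comodule_algebra begin

text \<open>
  If \<open>a \<in> A\<^sup>c\<^sup>o\<^sup>Q\<close>, then its slice by \<open>\<phi>\<close> is some \<open>k \<in> K = H\<^sup>c\<^sup>o\<^sup>Q\<close> with \<open>\<epsilon> k = \<phi> a\<close>, so \<open>k - \<phi>(a) 1 \<in> K\<^sup>+\<close>.
  Hence \<open>H/K\<^sup>+H\<close> has at least as many coinvariants in \<open>A\<close> as \<open>Q\<close>.
\<close>

lemma coinvariants_subset_plus_ideal:
  assumes I: "subspace I" and rI: "\<forall>x\<in>I. \<forall>h. x * h \<in> I"
    and K: "K = coinvariants scaleH scaleH \<Delta> (quot I)"
  shows "coinvariants scaleH scaleA \<delta> (quot I) \<subseteq> coinvariants scaleH scaleA \<delta> (quot (plus_ideal scaleH \<epsilon> K))"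
proof
  fix a assume a: "a \<in> coinvariants scaleH scaleA \<delta> (quot I)"
  have Kalg: "subalgebra scaleH K"
    using coinvariants_Sub_gen[OF I rI] unfolding K Sub_gen_iff by simp
  show "a \<in> coinvariants scaleH scaleA \<delta> (quot (plus_ideal scaleH \<epsilon> K))"
    unfolding coinvariants_iff[OF subspace_plus_ideal]
  proof (intro allI impI)
    fix \<phi> assume \<phi>: "Vector_Spaces.linear scaleA (*) \<phi>"
    have "slice scaleH \<delta> \<phi> a \<in> K" unfolding K by (rule slice_coinvariant[OF I a \<phi>])
    from minus_counit_mult_in_plus_ideal[OF Kalg this, of 1]
    show "slice scaleH \<delta> \<phi> a - scaleH (\<phi> a) 1 \<in> plus_ideal scaleH \<epsilon> K"
      by (simp add: counit_slice[OF \<phi>])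
  qed
qed

text \<open>
  \<open>H/K\<^sup>+H\<close> is one of the quotients whose join is \<open>\<psi>(A\<^sup>c\<^sup>o\<^sup>Q) = Q\<close>, so \<open>I \<subseteq> K\<^sup>+H\<close>; the other inclusion holds for
  every \<open>Q\<close>.
\<close>

lemma closed_Sub_Alg_imp_closed_Sub_gen:
  assumes Q: "Q \<in> carrier (Quot_gen scaleH \<Delta> \<epsilon>)"
    and closed: "closed_Sub_Alg scaleH \<Delta> \<epsilon> scaleA \<delta> (full_coinvariants scaleH scaleA \<delta>) Q"
  shows "closed_Sub_gen scaleH \<Delta> \<epsilon> Q"
proof -
  let ?L = "Quot_gen scaleH \<Delta> \<epsilon>" and ?ric = "right_ideal_coideal scaleH \<Delta> \<epsilon>"
  obtain I where I: "?ric I" "Q = quot I" using Q by (auto simp: Quot_gen_def)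
  then have sI: "subspace I" and rI: "\<forall>x\<in>I. \<forall>h. x * h \<in> I" by (auto simp: right_ideal_coideal_def)
  let ?S = "coinvariants scaleH scaleA \<delta> Q"
  let ?K = "coinvariants scaleH scaleH \<Delta> Q"
  let ?I' = "plus_ideal scaleH \<epsilon> ?K"
  have K: "?K \<in> Sub_gen scaleH \<Delta>" unfolding I(2) by (rule coinvariants_Sub_gen[OF sI rI])
  have I': "?ric ?I'" by (rule right_ideal_coideal_plus_ideal[OF K])
  let ?F = "{Q \<in> carrier ?L. ?S \<subseteq> coinvariants scaleH scaleA \<delta> Q}"
  have "full_coinvariants scaleH scaleA \<delta> \<subseteq> ?S"
    unfolding I(2) by (auto simp: coinvariants_iff[OF sI] full_coinvariants_slice subspace_0[OF sI])
  then have "?S \<in> Sub_Alg scaleA (full_coinvariants scaleH scaleA \<delta>)"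
    using subalgebra_coinvariants[OF sI rI] by (simp add: Sub_Alg_def I(2))
  then have "Q = \<Squnion>\<^bsub>?L\<^esub> ?F"
    using closed by (simp add: closed_Sub_Alg_def galois_psi_def)
  then have "least ?L Q (Upper ?L ?F)" using Quot_gen_join_least[of ?F] by auto
  moreover have "quot ?I' \<in> ?F"
    using I' coinvariants_subset_plus_ideal[OF sI rI] unfolding I(2) by (auto simp: Quot_gen_def)
  ultimately have "quot ?I' \<sqsubseteq>\<^bsub>?L\<^esub> Q"
    by (auto simp: least_def Upper_def)
  then have "I \<subseteq> ?I'" using Quot_gen_le_iff[OF I(1) I'] I(2) by simp
  moreover have "?I' \<subseteq> I" unfolding I(2) by (rule plus_ideal_coinvariants_subset[OF sI rI])
  ultimately show ?thesis unfolding closed_Sub_gen_def using I(2) by simp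
qed

end

section \<open>The canonical map\<close>

lemma frag_extend_diff_in:
  assumes "diff_closed N" "\<And>p. p \<in> Poly_Mapping.keys t \<Longrightarrow> b p - b' p \<in> N"
  shows "frag_extend b t - frag_extend b' t \<in> N"
  by (rule additive_frag_in[OF additive_diff_map[OF additive_frag_extend additive_frag_extend] assms(1) subset_refl])
    (simp add: assms(2))

text \<open>
  The relators of \<open>H \<otimes>\<^sub>K H\<close>.
\<close>

abbreviation balanced_rel :: "'h::{ring, monoid_mult} set \<Rightarrow> ('h \<times> 'h \<Rightarrow>\<^sub>0 int) set"
  where "balanced_rel K \<equiv> tensor_rel K
      \<lparr>elems = UNIV, madd = (+), mact = (\<lambda>r x. x * r)\<rparr> \<lparr>elems = UNIV, madd = (+), mact = (\<lambda>r x. r * x)\<rparr>"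

abbreviation balanced_class :: "'h::{ring, monoid_mult} set \<Rightarrow> ('h \<times> 'h \<Rightarrow>\<^sub>0 int) \<Rightarrow> ('h \<times> 'h \<Rightarrow>\<^sub>0 int) set"
  where "balanced_class K \<equiv> tensor_class K
      \<lparr>elems = UNIV, madd = (+), mact = (\<lambda>r x. x * r)\<rparr> \<lparr>elems = UNIV, madd = (+), mact = (\<lambda>r x. r * x)\<rparr>"

lemma balanced_rel_swap:
  "r \<in> K \<Longrightarrow> frag_of (m * r, n) - frag_of (m, r * n) \<in> balanced_rel K"
  using tensor_rel.balanced[of r K m "\<lparr>elems = UNIV, madd = (+), mact = (\<lambda>r x. x * r)\<rparr>"
      n "\<lparr>elems = UNIV, madd = (+), mact = (\<lambda>r x. r * x)\<rparr>"] by simp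

lemma balanced_class_in_carrier: "balanced_class K t \<in> tensor_over_subalgebra K"
  unfolding tensor_over_subalgebra_def tensor_carrier_def tensor_sums_def by simp

context hopf_algebra begin

lemma tensor_rel_subset_balanced_rel:
  assumes "subalgebra scaleH K"
  shows "HH.trel \<subseteq> balanced_rel K"
proof
  let ?r = "\<lparr>elems = UNIV, madd = (+), mact = (\<lambda>r x. x * r)\<rparr> :: ('h, 'h) kmod"
  let ?l = "\<lparr>elems = UNIV, madd = (+), mact = (\<lambda>r x. r * x)\<rparr> :: ('h, 'h) kmod"
  fix t assume "t \<in> HH.trel"
  then show "t \<in> balanced_rel K"
  proof (rule additive_tensor_rel[OF additive_id diff_closed_tensor_rel])
    fix m m' n
    show "frag_of (madd (vs scaleH) m m', n) - frag_of (m, n) - frag_of (m', n) \<in> balanced_rel K"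
      using tensor_rel.add_left[of m ?r m' n ?l] by simp
  next
    fix m n n'
    show "frag_of (m, madd (vs scaleH) n n') - frag_of (m, n) - frag_of (m, n') \<in> balanced_rel K"
      using tensor_rel.add_right[of m ?r n ?l n'] by simp
  next
    fix c m n
    have "scaleH c 1 \<in> K" using assms by (simp add: subalgebra_def subspace_scale)
    from balanced_rel_swap[OF this, of m n]
    show "frag_of (mact (vs scaleH) c m, n) - frag_of (m, mact (vs scaleH) c n) \<in> balanced_rel K"
      by (simp add: scale_mult_left scale_mult_right)
  qed
qed

lemma linear_simps:
  "Vector_Spaces.linear scaleH (*) \<phi> \<Longrightarrow> \<phi> (x + y) = \<phi> x + \<phi> y"
  "Vector_Spaces.linear scaleH (*) \<phi> \<Longrightarrow> \<phi> (scaleH c x) = c * \<phi> x"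
  by (simp_all add: Vector_Spaces.linear_iff)

lemma antipode_simps:
  "antipode (x + y) = antipode x + antipode y" "antipode (scaleH c x) = scaleH c (antipode x)"
  using antipode_linear by (simp_all add: Vector_Spaces.linear_iff)

lemma counit_simps:
  "\<epsilon> (x + y) = \<epsilon> x + \<epsilon> y" "\<epsilon> (scaleH c x) = c * \<epsilon> x"
  using counit_linear by (simp_all add: Vector_Spaces.linear_iff)

lemmas mult_scale_simps = distrib_left distrib_right scale_mult_left scale_mult_right

lemma field_vector_space: "vector_space ((*) :: 'k \<Rightarrow> 'k \<Rightarrow> 'k)"
  by unfold_locales (simp_all add: algebra_simps)

lemma bilinear_slice:
  assumes "bilinear scaleH scaleH (*) F"
  shows "bilinear scaleH scaleH scaleH (\<lambda>u v. slice scaleH \<Delta> (F u) v)"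
proof -
  have "F (u + u') = (\<lambda>z. F u z + F u' z)" "F (scaleH c u) = (\<lambda>z. c * F u z)" for u u' c
    using assms by (auto simp: bilinear_def Vector_Spaces.linear_iff)
  moreover have "slice scaleH \<Delta> (\<lambda>z. F u z + F u' z) v = slice scaleH \<Delta> (F u) v + slice scaleH \<Delta> (F u') v"
    "slice scaleH \<Delta> (\<lambda>z. c * F u z) v = scaleH c (slice scaleH \<Delta> (F u) v)" for u u' c v
    by (simp_all add: slice_def scale_left_distrib tensor_eval_plus tensor_eval_scale[symmetric])
  moreover have "Vector_Spaces.linear scaleH scaleH (slice scaleH \<Delta> (F u))" for u
    by (rule comodule_algebra.linear_slice[OF regular]) (use assms in \<open>simp add: bilinear_def\<close>)
  ultimately show ?thesis
    using vector_space_axioms by (simp add: bilinear_def Vector_Spaces.linear_iff)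
qed

text \<open>
  Regrouping by coassociativity exposes \<open>S(g\<^sub>1) g\<^sub>2\<close> inside \<open>\<Sum> \<phi>(h S(g\<^sub>1) g\<^sub>2) g\<^sub>3\<close>, which the antipode
  axiom and the counit cancel.
\<close>

lemma slice_antipode_left:
  assumes \<phi>: "Vector_Spaces.linear scaleH (*) \<phi>"
  shows "tensor_eval scaleH (\<lambda>u v. slice scaleH \<Delta> (\<lambda>w. \<phi> (h * antipode u * w)) v) (\<Delta> g) = scaleH (\<phi> h) g"
proof -
  have tri: "trilinear scaleH scaleH scaleH scaleH (\<lambda>u v w. scaleH (\<phi> (h * antipode u * v)) w)"
    using vector_space_axioms
    by (simp add: trilinear_def bilinear_def Vector_Spaces.linear_iff linear_simps[OF \<phi>] antipode_simps
        mult_scale_simps scale_left_distrib scale_right_distrib mult.commute)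
  have lin: "Vector_Spaces.linear scaleH scaleH (\<lambda>z. scaleH (\<phi> (h * z)) w)" for w
    using vector_space_axioms
    by (simp add: Vector_Spaces.linear_iff linear_simps[OF \<phi>] mult_scale_simps scale_left_distrib)
  have "tensor_eval scaleH (\<lambda>u v. slice scaleH \<Delta> (\<lambda>w. \<phi> (h * antipode u * w)) v) (\<Delta> g) =
      tensor_eval scaleH (\<lambda>x w. tensor_eval scaleH (\<lambda>u v. scaleH (\<phi> (h * antipode u * v)) w) (\<Delta> x)) (\<Delta> g)"
    unfolding slice_def by (rule comodule_algebra.coaction_eval_coassoc[OF regular tri, symmetric])
  also have "\<dots> = tensor_eval scaleH (\<lambda>x w. scaleH (\<phi> (h * scaleH (\<epsilon> x) 1)) w) (\<Delta> g)"
    unfolding antipode_left[symmetric] linear_tensor_eval[OF lin] by (simp add: mult.assoc)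
  also have "\<dots> = tensor_eval scaleH (\<lambda>x w. scaleH (\<phi> h) (scaleH (\<epsilon> x) w)) (\<Delta> g)"
    by (simp add: mult_scale_simps linear_simps[OF \<phi>] mult.commute)
  also have "\<dots> = scaleH (\<phi> h) g"
    by (simp only: tensor_eval_scale counit_left)
  finally show ?thesis .
qed

text \<open>
  The mirror image, cancelling \<open>g\<^sub>1 S(g\<^sub>2)\<close> in \<open>\<Sum> \<phi>(h g\<^sub>1 S(g\<^sub>2)) g\<^sub>3\<close>.
\<close>

lemma slice_antipode_right:
  assumes \<phi>: "Vector_Spaces.linear scaleH (*) \<phi>"
  shows "tensor_eval scaleH (\<lambda>u v. slice scaleH \<Delta> (\<lambda>w. \<phi> (h * u * antipode w)) v) (\<Delta> g) = scaleH (\<phi> h) g"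
proof -
  have tri: "trilinear scaleH scaleH scaleH scaleH (\<lambda>u v w. scaleH (\<phi> (h * u * antipode v)) w)"
    using vector_space_axioms
    by (simp add: trilinear_def bilinear_def Vector_Spaces.linear_iff linear_simps[OF \<phi>] antipode_simps
        mult_scale_simps scale_left_distrib scale_right_distrib mult.commute)
  have lin: "Vector_Spaces.linear scaleH scaleH (\<lambda>z. scaleH (\<phi> (h * z)) w)" for w
    using vector_space_axioms
    by (simp add: Vector_Spaces.linear_iff linear_simps[OF \<phi>] mult_scale_simps scale_left_distrib)
  have "tensor_eval scaleH (\<lambda>u v. slice scaleH \<Delta> (\<lambda>w. \<phi> (h * u * antipode w)) v) (\<Delta> g) =
      tensor_eval scaleH (\<lambda>x w. tensor_eval scaleH (\<lambda>u v. scaleH (\<phi> (h * u * antipode v)) w) (\<Delta> x)) (\<Delta> g)"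
    unfolding slice_def by (rule comodule_algebra.coaction_eval_coassoc[OF regular tri, symmetric])
  also have "\<dots> = tensor_eval scaleH (\<lambda>x w. scaleH (\<phi> (h * scaleH (\<epsilon> x) 1)) w) (\<Delta> g)"
    unfolding antipode_right[symmetric] linear_tensor_eval[OF lin] by (simp add: mult.assoc)
  also have "\<dots> = tensor_eval scaleH (\<lambda>x w. scaleH (\<phi> h) (scaleH (\<epsilon> x) w)) (\<Delta> g)"
    by (simp add: mult_scale_simps linear_simps[OF \<phi>] mult.commute)
  also have "\<dots> = scaleH (\<phi> h) g"
    by (simp only: tensor_eval_scale counit_left)
  finally show ?thesis .
qed

lemma counit_antipode: "\<epsilon> (antipode h) = \<epsilon> h"
proof -
  have lin: "Vector_Spaces.linear scaleH (*) (\<lambda>z. \<epsilon> (antipode z))"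
    using counit_linear antipode_linear by (simp add: Vector_Spaces.linear_iff)
  have "\<epsilon> h = \<epsilon> (tensor_eval scaleH (\<lambda>x y. antipode x * y) (\<Delta> h))"
    by (simp add: antipode_left counit_simps counit_one)
  also have "\<dots> = tensor_eval (*) (\<lambda>x y. \<epsilon> (antipode (scaleH (\<epsilon> y) x))) (\<Delta> h)"
    unfolding linear_tensor_eval[OF counit_linear]
    by (simp add: counit_mult counit_simps antipode_simps mult.commute)
  also have "\<dots> = \<epsilon> (antipode (tensor_eval scaleH (\<lambda>x y. scaleH (\<epsilon> y) x) (\<Delta> h)))"
    by (rule linear_tensor_eval[OF lin, symmetric])
  finally show ?thesis by (simp only: counit_right)
qed

text \<open>
  The maps \<open>h \<otimes> g \<mapsto> h g\<^sub>1 \<otimes> g\<^sub>2\<close> and \<open>h \<otimes> g \<mapsto> h S(g\<^sub>1) \<otimes> g\<^sub>2\<close> on formal sums, mutually inverse on \<open>H \<otimes> H\<close>.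
  The canonical map of \<open>Q\<close> is the first one followed by \<open>id \<otimes> \<pi>\<close>.
\<close>

definition galois :: "('h \<times> 'h \<Rightarrow>\<^sub>0 int) \<Rightarrow> ('h \<times> 'h \<Rightarrow>\<^sub>0 int)"
  where "galois = frag_extend (\<lambda>(h, g). frag_extend (\<lambda>(u, v). frag_of (h * u, v)) (rep (\<Delta> g)))"

definition galois_inv :: "('h \<times> 'h \<Rightarrow>\<^sub>0 int) \<Rightarrow> ('h \<times> 'h \<Rightarrow>\<^sub>0 int)"
  where "galois_inv = frag_extend (\<lambda>(h, g). frag_extend (\<lambda>(u, v). frag_of (h * antipode u, v)) (rep (\<Delta> g)))"

lemma galois_eval:
  "lin_ext scaleH (\<lambda>(x, y). scaleH (\<phi> x) y) (galois t) =
   lin_ext scaleH (\<lambda>(h, g). slice scaleH \<Delta> (\<lambda>u. \<phi> (h * u)) g) t"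
  by (simp add: galois_def lin_ext_frag_extend slice_lin_ext split_def)

lemma galois_inv_eval:
  "lin_ext scaleH (\<lambda>(x, y). scaleH (\<phi> x) y) (galois_inv t) =
   lin_ext scaleH (\<lambda>(h, g). slice scaleH \<Delta> (\<lambda>u. \<phi> (h * antipode u)) g) t"
  by (simp add: galois_inv_def lin_ext_frag_extend slice_lin_ext split_def)

lemma additive_galois: "additive galois" and additive_galois_inv: "additive galois_inv"
  unfolding galois_def galois_inv_def by (rule additive_frag_extend)+

lemma galois_galois_inv: "galois (galois_inv t) - t \<in> HH.trel"
  unfolding HH.tensor_zero_iff
proof (intro allI impI)
  fix \<phi> assume \<phi>: "Vector_Spaces.linear scaleH (*) \<phi>"
  have "lin_ext scaleH (\<lambda>(x, y). scaleH (\<phi> x) y) (galois (galois_inv t)) =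
      lin_ext scaleH (\<lambda>(h, g). tensor_eval scaleH (\<lambda>u v. slice scaleH \<Delta> (\<lambda>w. \<phi> (h * antipode u * w)) v) (\<Delta> g)) t"
    unfolding galois_eval by (simp add: galois_inv_def lin_ext_frag_extend tensor_eval_lin_ext split_def)
  then show "lin_ext scaleH (\<lambda>(x, y). scaleH (\<phi> x) y) (galois (galois_inv t) - t) = 0"
    by (simp add: lin_ext_diff slice_antipode_left[OF \<phi>])
qed

lemma galois_inv_galois: "galois_inv (galois t) - t \<in> HH.trel"
  unfolding HH.tensor_zero_iff
proof (intro allI impI)
  fix \<phi> assume \<phi>: "Vector_Spaces.linear scaleH (*) \<phi>"
  have "lin_ext scaleH (\<lambda>(x, y). scaleH (\<phi> x) y) (galois_inv (galois t)) =
      lin_ext scaleH (\<lambda>(h, g). tensor_eval scaleH (\<lambda>u v. slice scaleH \<Delta> (\<lambda>w. \<phi> (h * u * antipode w)) v) (\<Delta> g)) t"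
    unfolding galois_inv_eval by (simp add: galois_def lin_ext_frag_extend tensor_eval_lin_ext split_def)
  then show "lin_ext scaleH (\<lambda>(x, y). scaleH (\<phi> x) y) (galois_inv (galois t) - t) = 0"
    by (simp add: lin_ext_diff slice_antipode_right[OF \<phi>])
qed

lemma galois_inv_tensor_rel:
  assumes "t \<in> HH.trel"
  shows "galois_inv t \<in> HH.trel"
  unfolding HH.tensor_zero_iff galois_inv_eval
proof (intro allI impI)
  fix \<phi> assume \<phi>: "Vector_Spaces.linear scaleH (*) \<phi>"
  have "bilinear scaleH scaleH (*) (\<lambda>h u. \<phi> (h * antipode u))"
    using vector_space_axioms field_vector_space
    by (simp add: bilinear_def Vector_Spaces.linear_iff linear_simps[OF \<phi>] antipode_simps mult_scale_simps)
  from lin_ext_bilinear_tensor_rel[OF bilinear_slice[OF this] assms]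
  show "lin_ext scaleH (\<lambda>(h, g). slice scaleH \<Delta> (\<lambda>u. \<phi> (h * antipode u)) g) t = 0" .
qed

text \<open>
  The canonical map is well defined on \<open>H \<otimes>\<^sub>K H\<close>: for \<open>r \<in> K\<close> the product identity for slices compares
  \<open>\<phi>(m r \<cdot>)\<close> on \<open>n\<close> with \<open>\<phi>(m \<cdot>)\<close> on \<open>r n\<close>.
\<close>

lemma slice_balanced:
  assumes I: "subspace I" and rI: "\<forall>x\<in>I. \<forall>h. x * h \<in> I"
    and K: "K = coinvariants scaleH scaleH \<Delta> (quot I)"
    and \<phi>: "Vector_Spaces.linear scaleH (*) \<phi>" and t: "t \<in> balanced_rel K"
  shows "lin_ext scaleH (\<lambda>(h, g). slice scaleH \<Delta> (\<lambda>u. \<phi> (h * u)) g) t \<in> I"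
proof -
  have "bilinear scaleH scaleH (*) (\<lambda>h u. \<phi> (h * u))"
    using vector_space_axioms field_vector_space
    by (simp add: bilinear_def Vector_Spaces.linear_iff linear_simps[OF \<phi>] mult_scale_simps)
  note bil = bilinear_slice[OF this]
  show ?thesis
  proof (rule additive_tensor_rel[OF additive_lin_ext diff_closed_subspace[OF I] t], goal_cases)
    case (1 m m' n)
    then show ?case using bil by (simp add: bilinear_def Vector_Spaces.linear_iff subspace_0[OF I])
  next
    case (2 m n n')
    then show ?case using bil by (simp add: bilinear_def Vector_Spaces.linear_iff subspace_0[OF I])
  next
    case (3 r m n)
    have lin: "Vector_Spaces.linear scaleH (*) (\<lambda>u. \<phi> (m * u))"
      by (rule comodule_algebra.linear_mult_functional(2)[OF regular \<phi>])
    note r = \<open>r \<in> K\<close>[unfolded K comodule_algebra.coinvariants_iff[OF regular I], rule_format]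
    have "slice scaleH \<Delta> (\<lambda>u. \<phi> (m * u)) (r * n) - slice scaleH \<Delta> (\<lambda>y. \<phi> (m * (r * y))) n \<in> I"
      unfolding comodule_algebra.slice_mult_diff[OF regular lin]
      by (intro tensor_eval_in[OF I] rI[rule_format] r
          comodule_algebra.linear_mult_functional(1)[OF regular lin])
    from diff_closed_sym[OF diff_closed_subspace[OF I] this]
    show ?case by (simp add: mult.assoc)
  qed
qed

text \<open>
  \<open>h \<otimes> g \<mapsto> \<epsilon>(h) g\<close> is well defined as a map \<open>H \<otimes>\<^sub>K H \<rightarrow> H/K\<^sup>+H\<close>, because \<open>r \<equiv> \<epsilon>(r) 1\<close> for \<open>r \<in> K\<close>.
\<close>

lemma counit_balanced:
  assumes K: "subalgebra scaleH K" and t: "t \<in> balanced_rel K"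
  shows "lin_ext scaleH (\<lambda>(h, g). scaleH (\<epsilon> h) g) t \<in> plus_ideal scaleH \<epsilon> K"
proof (rule additive_tensor_rel[OF additive_lin_ext diff_closed_subspace[OF subspace_plus_ideal] t], goal_cases)
  case (3 r m n)
  have "(r - scaleH (\<epsilon> r) 1) * n \<in> plus_ideal scaleH \<epsilon> K"
    using 3 by (intro minus_counit_mult_in_plus_ideal[OF K])
  from diff_closedD(3)[OF diff_closed_subspace[OF subspace_plus_ideal] subspace_scale[OF subspace_plus_ideal this, of "\<epsilon> m"]]
  show ?case by (simp add: counit_mult left_diff_distrib scale_mult_left scale_right_diff_distrib)
qed (simp_all add: counit_simps scale_left_distrib scale_right_distrib subspace_0[OF subspace_plus_ideal])

text \<open>
  In Sweedler notation, the tensor \<open>w = \<Sum> a S(g\<^sub>1) S(x\<^sub>1) \<otimes> x\<^sub>2 g\<^sub>2\<close> is mapped by \<open>galois\<close> to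
  \<open>a S(g\<^sub>1) S(x\<^sub>1) x\<^sub>2 g\<^sub>2 \<otimes> x\<^sub>3 g\<^sub>3 = a \<otimes> x g\<close>, so \<open>w\<close> is the image of \<open>a \<otimes> x g\<close> under \<open>galois_inv\<close>. Now \<open>x\<^sub>2\<close> can be chosen in the left
  coideal \<open>K\<close> and moved across the balanced tensor sign, which gives \<open>a S(g\<^sub>1) S(x\<^sub>1) x\<^sub>2 \<otimes> g\<^sub>2 = \<epsilon>(x) (\<dots>) = 0\<close>.
\<close>

lemma galois_inv_plus_ideal_generator:
  assumes K: "K \<in> Sub_gen scaleH \<Delta>" and x: "x \<in> K" "\<epsilon> x = 0"
  shows "galois_inv (frag_of (a, x * g)) \<in> balanced_rel K"
proof -
  note tc = diff_closed_tensor_rel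
  have Kalg: "subalgebra scaleH K" and Kco: "\<Delta> x \<in> tensor_sums UNIV (vs scaleH) (vs scaleH) (UNIV \<times> K)"
    using K x(1) by (simp_all add: Sub_gen_def)
  note sub = subsetD[OF tensor_rel_subset_balanced_rel[OF Kalg]]
  obtain d where d: "Poly_Mapping.keys d \<subseteq> UNIV \<times> K" "rep (\<Delta> x) - d \<in> HH.trel"
    using tensor_class_in_sums_iff[of UNIV "vs scaleH" "vs scaleH" "rep (\<Delta> x)" "UNIV \<times> K"] Kco
    unfolding comult_class by blast
  have d_eval: "lin_ext scaleH (\<lambda>(u, k). f u k) d = tensor_eval scaleH f (\<Delta> x)"
    if "bilinear scaleH scaleH scaleH f" for f
    unfolding tensor_eval_lin_ext by (rule lin_ext_bilinear_cong[OF that d(2), symmetric])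
  define w where "w = frag_extend (\<lambda>(p, q). frag_extend (\<lambda>(u, k). frag_of (a * antipode p * antipode u, k * q)) d) (rep (\<Delta> g))"
  define w' where "w' = frag_extend (\<lambda>(p, q). frag_extend (\<lambda>(u, k). frag_of (a * antipode p * antipode u * k, q)) d) (rep (\<Delta> g))"
  have "galois w - frag_of (a, x * g) \<in> HH.trel"
    unfolding HH.tensor_zero_iff
  proof (intro allI impI)
    fix \<phi> assume \<phi>: "Vector_Spaces.linear scaleH (*) \<phi>"
    have linx: "Vector_Spaces.linear scaleH scaleH (\<lambda>z. x * z)"
      using vector_space_axioms by (simp add: Vector_Spaces.linear_iff mult_scale_simps)
    have linr: "Vector_Spaces.linear scaleH scaleH (\<lambda>z. z * v)" for v
      using vector_space_axioms by (simp add: Vector_Spaces.linear_iff mult_scale_simps)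
    have bil: "bilinear scaleH scaleH scaleH (\<lambda>u v. slice scaleH \<Delta> (\<lambda>z. \<phi> (b * antipode u * z)) (v * q))" for b q
    proof -
      have "bilinear scaleH scaleH (*) (\<lambda>u z. \<phi> (b * antipode u * z))"
        using vector_space_axioms field_vector_space
        by (simp add: bilinear_def Vector_Spaces.linear_iff linear_simps[OF \<phi>] antipode_simps mult_scale_simps)
      from bilinear_slice[OF this] show ?thesis
        by (simp add: bilinear_def Vector_Spaces.linear_iff mult_scale_simps)
    qed
    \<comment> \<open>the coproduct of \<open>x\<close> collapses first: \<open>\<Sum> \<phi>(b S(x\<^sub>1) x\<^sub>2 q\<^sub>1) x\<^sub>3 q\<^sub>2 = x \<Sum> \<phi>(b q\<^sub>1) q\<^sub>2\<close>\<close>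
    have inner: "tensor_eval scaleH (\<lambda>u v. slice scaleH \<Delta> (\<lambda>z. \<phi> (b * antipode u * z)) (v * q)) (\<Delta> x) =
        x * slice scaleH \<Delta> (\<lambda>y. \<phi> (b * y)) q" for b q
    proof -
      have lin: "Vector_Spaces.linear scaleH (*) (\<lambda>z. \<phi> (b * antipode u * z))" for u
        by (rule comodule_algebra.linear_mult_functional(2)[OF regular \<phi>])
      have "tensor_eval scaleH (\<lambda>u v. slice scaleH \<Delta> (\<lambda>z. \<phi> (b * antipode u * z)) (v * q)) (\<Delta> x) =
          tensor_eval scaleH (\<lambda>y w. tensor_eval scaleH
            (\<lambda>u v. slice scaleH \<Delta> (\<lambda>z. \<phi> (b * antipode u * (z * y))) v * w) (\<Delta> x)) (\<Delta> q)"
        unfolding comodule_algebra.slice_mult[OF regular lin] by (rule tensor_eval_swap)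
      also have "\<dots> = tensor_eval scaleH (\<lambda>y w. scaleH (\<phi> (b * y)) x * w) (\<Delta> q)"
      proof -
        have "tensor_eval scaleH (\<lambda>u v. slice scaleH \<Delta> (\<lambda>z. \<phi> (b * antipode u * (z * y))) v * w) (\<Delta> x) =
            scaleH (\<phi> (b * y)) x * w" for y w
          unfolding linear_tensor_eval[OF linr, symmetric]
          using slice_antipode_left[OF comodule_algebra.linear_mult_functional(1)[OF regular \<phi>], of b y x]
          by (simp add: mult.assoc)
        then show ?thesis by simp
      qed
      also have "\<dots> = x * slice scaleH \<Delta> (\<lambda>y. \<phi> (b * y)) q"
        unfolding slice_def linear_tensor_eval[OF linx] by (simp add: mult_scale_simps)
      finally show ?thesis .
    qed
    have "lin_ext scaleH (\<lambda>(x, y). scaleH (\<phi> x) y) (galois w) =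
        tensor_eval scaleH (\<lambda>p q. x * slice scaleH \<Delta> (\<lambda>y. \<phi> (a * antipode p * y)) q) (\<Delta> g)"
      unfolding galois_eval w_def lin_ext_frag_extend tensor_eval_lin_ext[of _ _ "\<Delta> g"]
      using d_eval[OF bil] by (simp add: split_def lin_ext_frag_extend inner)
    also have "\<dots> = scaleH (\<phi> a) (x * g)"
      unfolding linear_tensor_eval[OF linx, symmetric] slice_antipode_left[OF \<phi>]
      by (simp add: mult_scale_simps)
    finally show "lin_ext scaleH (\<lambda>(x, y). scaleH (\<phi> x) y) (galois w - frag_of (a, x * g)) = 0"
      by (simp add: lin_ext_diff)
  qed
  from galois_inv_tensor_rel[OF this]
  have "galois_inv (galois w) - galois_inv (frag_of (a, x * g)) \<in> HH.trel"
    by (simp add: additive.diff[OF additive_galois_inv])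
  from diff_closed_trans[OF tc diff_closed_sym[OF tc this] galois_inv_galois]
  have 1: "galois_inv (frag_of (a, x * g)) - w \<in> balanced_rel K" by (rule sub)
  have "w' - w \<in> balanced_rel K"
    unfolding w_def w'_def
    by (intro frag_extend_diff_in[OF tc])
      (use d(1) in \<open>auto intro!: frag_extend_diff_in[OF tc] balanced_rel_swap\<close>)
  note 2 = diff_closed_sym[OF tc this]
  have "w' \<in> HH.trel"
    unfolding HH.tensor_zero_iff
  proof (intro allI impI)
    fix \<phi> assume \<phi>: "Vector_Spaces.linear scaleH (*) \<phi>"
    have bil: "bilinear scaleH scaleH scaleH (\<lambda>u v. scaleH (\<phi> (b * antipode u * v)) q)" for b q
      using vector_space_axioms
      by (simp add: bilinear_def Vector_Spaces.linear_iff linear_simps[OF \<phi>] antipode_simps mult_scale_simps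
          scale_left_distrib)
    have lin: "Vector_Spaces.linear scaleH scaleH (\<lambda>z. scaleH (\<phi> (b * z)) q)" for b q
      using vector_space_axioms
      by (simp add: Vector_Spaces.linear_iff linear_simps[OF \<phi>] mult_scale_simps scale_left_distrib)
    have "tensor_eval scaleH (\<lambda>u v. scaleH (\<phi> (b * antipode u * v)) q) (\<Delta> x) = 0" for b q
      using linear_tensor_eval[OF lin, of b "\<lambda>u v. antipode u * v" "\<Delta> x" q] linear_zero[OF \<phi>]
      by (simp add: antipode_left x(2) mult.assoc)
    then have "lin_ext scaleH (\<lambda>(u, k). scaleH (\<phi> (b * antipode u * k)) q) d = 0" for b q
      unfolding d_eval[OF bil] .
    then show "lin_ext scaleH (\<lambda>(x, y). scaleH (\<phi> x) y) w' = 0"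
      unfolding w'_def lin_ext_frag_extend by (simp add: split_def lin_ext_frag_extend) (simp add: lin_ext_def)
  qed
  then have "w' \<in> balanced_rel K" by (rule sub)
  then show ?thesis
    using diff_closed_cong[OF tc diff_closed_trans[OF tc 1 2]] by simp
qed

lemma galois_inv_plus_ideal:
  assumes K: "K \<in> Sub_gen scaleH \<Delta>" and y: "y \<in> plus_ideal scaleH \<epsilon> K"
  shows "galois_inv (frag_of (a, y)) \<in> balanced_rel K"
proof -
  note tc = diff_closed_tensor_rel
  have Kalg: "subalgebra scaleH K" using K by (simp add: Sub_gen_def)
  have cong: "galois_inv s \<in> balanced_rel K \<longleftrightarrow> galois_inv t \<in> balanced_rel K" if "s - t \<in> HH.trel" for s t
  proof (rule diff_closed_cong[OF tc])
    show "galois_inv s - galois_inv t \<in> balanced_rel K"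
      using subsetD[OF tensor_rel_subset_balanced_rel[OF Kalg] galois_inv_tensor_rel[OF that]]
      by (simp add: additive.diff[OF additive_galois_inv])
  qed
  let ?S = "{y. \<forall>a. galois_inv (frag_of (a, y)) \<in> balanced_rel K}"
  have "subspace ?S"
  proof (rule subspaceI)
    show "0 \<in> ?S"
      using subsetD[OF tensor_rel_subset_balanced_rel[OF Kalg] galois_inv_tensor_rel[OF HH.trel_zero_right]] by simp
  next
    fix y z assume "y \<in> ?S" "z \<in> ?S"
    then show "y + z \<in> ?S"
      using cong[OF HH.trel_add_right] by (simp add: additive.add[OF additive_galois_inv] diff_closedD(4)[OF tc])
  next
    fix c y assume "y \<in> ?S"
    then show "scaleH c y \<in> ?S" by (simp add: cong[OF HH.trel_scale, symmetric])
  qed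
  then have "plus_ideal scaleH \<epsilon> K \<subseteq> ?S"
    by (rule plus_ideal_subset) (simp add: galois_inv_plus_ideal_generator[OF K])
  then show ?thesis using y by blast
qed

lemma can_galois:
  "can scaleH \<Delta> Q X = tensor_class UNIV (vs scaleH) (quot_mod scaleH Q)
    (frag_extend (\<lambda>(x, y). frag_of (x, proj Q y)) (galois (rep X)))"
proof -
  have "frag_extend (\<lambda>(h, h'). frag_extend (\<lambda>(u, v). frag_of (h * u, proj Q v)) (rep (\<Delta> h'))) t =
      frag_extend (\<lambda>(x, y). frag_of (x, proj Q y)) (galois t)" for t
  proof (rule additive_frag_eq[OF additive_frag_extend additive_comp[OF additive_frag_extend additive_galois] subset_UNIV])
    fix p
    have "frag_extend (\<lambda>(u, v). frag_of (h * u, proj Q v)) s =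
        frag_extend (\<lambda>(x, y). frag_of (x, proj Q y)) (frag_extend (\<lambda>(u, v). frag_of (h * u, v)) s)" for h s
      by (rule additive_frag_eq[OF additive_frag_extend additive_comp[OF additive_frag_extend additive_frag_extend] subset_UNIV])
        auto
    then show "frag_extend (\<lambda>(h, h'). frag_extend (\<lambda>(u, v). frag_of (h * u, proj Q v)) (rep (\<Delta> h'))) (frag_of p) =
        frag_extend (\<lambda>(x, y). frag_of (x, proj Q y)) (galois (frag_of p))"
      by (simp add: galois_def split_def)
  qed
  then show ?thesis by (simp add: can_def tensor_lift_def)
qed

lemma can_eq_iff:
  assumes I: "subspace I"
  shows "can scaleH \<Delta> (quot I) X = can scaleH \<Delta> (quot I) Y \<longleftrightarrow>
    (\<forall>\<phi>. Vector_Spaces.linear scaleH (*) \<phi> \<longrightarrow>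
      lin_ext scaleH (\<lambda>(h, g). slice scaleH \<Delta> (\<lambda>u. \<phi> (h * u)) g) (rep X - rep Y) \<in> I)"
  unfolding can_galois tensor_class_eq_iff frag_extend_diff[symmetric] additive.diff[OF additive_galois, symmetric]
    HH.projected_tensor_zero_iff[OF I] galois_eval ..

text \<open>
  Through \<open>galois\<close>, which identifies \<open>H \<otimes>\<^sub>K H\<close> with \<open>H \<otimes> H/K\<^sup>+H\<close>, the canonical map becomes the projection
  \<open>H \<otimes> H/K\<^sup>+H \<rightarrow> H \<otimes> H/I\<close>. It is always onto, and it is injective exactly when \<open>K\<^sup>+H = I\<close>.
\<close>

lemma closed_Sub_gen_iff_can_bij:
  assumes Q: "Q \<in> carrier (Quot_gen scaleH \<Delta> \<epsilon>)"
  shows "closed_Sub_gen scaleH \<Delta> \<epsilon> Q \<longleftrightarrow>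
    bij_betw (can scaleH \<Delta> Q) (tensor_over_subalgebra (coinvariants scaleH scaleH \<Delta> Q))
      (elems (tensor (vs scaleH) (quot_mod scaleH Q)))"
proof -
  note tc = diff_closed_tensor_rel
  obtain I where I: "right_ideal_coideal scaleH \<Delta> \<epsilon> I" "Q = quot I" using Q by (auto simp: Quot_gen_def)
  then have sI: "subspace I" and rI: "\<forall>x\<in>I. \<forall>h. x * h \<in> I" by (auto simp: right_ideal_coideal_def)
  note Ic = diff_closed_subspace[OF sI]
  define K where "K = coinvariants scaleH scaleH \<Delta> (quot I)"
  have K: "K \<in> Sub_gen scaleH \<Delta>" unfolding K_def by (rule coinvariants_Sub_gen[OF sI rI])
  then have Kalg: "subalgebra scaleH K" by (simp add: Sub_gen_def)
  note trel_sub = subsetD[OF tensor_rel_subset_balanced_rel[OF Kalg]]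
  let ?can = "can scaleH \<Delta> (quot I)"
  let ?T = "tensor_over_subalgebra K"
  let ?q = "\<lambda>\<phi> t. lin_ext scaleH (\<lambda>(h, g). slice scaleH \<Delta> (\<lambda>u. \<phi> (h * u)) g) t"
  let ?P = "frag_extend (\<lambda>(x, y). frag_of (x, proj (quot I) y))"
  have class_rep: "balanced_class K (rep X) = X" if "X \<in> ?T" for X
    using that unfolding tensor_over_subalgebra_def by (rule tensor_class_rep)
  have closed_iff: "closed_Sub_gen scaleH \<Delta> \<epsilon> (quot I) \<longleftrightarrow> I = plus_ideal scaleH \<epsilon> K"
    unfolding closed_Sub_gen_def K_def[symmetric] using quot_inject[OF sI subspace_plus_ideal] by blast
  have "I = plus_ideal scaleH \<epsilon> K" if inj: "inj_on ?can ?T"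
  proof
    show "plus_ideal scaleH \<epsilon> K \<subseteq> I" unfolding K_def by (rule plus_ideal_coinvariants_subset[OF sI rI])
    show "I \<subseteq> plus_ideal scaleH \<epsilon> K"
    proof
      fix y assume y: "y \<in> I"
      \<comment> \<open>\<open>\<Sum> S(y\<^sub>1) \<otimes> y\<^sub>2\<close>: the canonical map sends it to \<open>1 \<otimes> \<pi>(y) = 0\<close>, while \<open>\<epsilon> \<otimes> id\<close> returns \<open>y\<close>\<close>
      let ?t = "galois_inv (frag_of (1, y))"
      let ?X = "balanced_class K ?t" and ?Y = "balanced_class K 0"
      have XY: "(rep ?X - rep ?Y) - ?t \<in> balanced_rel K"
      proof -
        have "(rep ?X - rep ?Y) - ?t = (rep ?X - ?t) - (rep ?Y - 0)" by simp
        also have "\<dots> \<in> balanced_rel K" by (rule diff_closedD(2)[OF tc rep_tensor_class rep_tensor_class])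
        finally show ?thesis .
      qed
      have "?can ?X = ?can ?Y"
        unfolding can_eq_iff[OF sI]
      proof (intro allI impI)
        fix \<phi> assume \<phi>: "Vector_Spaces.linear scaleH (*) \<phi>"
        have "?q \<phi> ?t = scaleH (\<phi> 1) y"
          using HH.tensor_zero_iff[THEN iffD1, OF galois_galois_inv[of "frag_of (1, y)"]] \<phi>
          by (simp add: lin_ext_diff galois_eval)
        then have "?q \<phi> ?t \<in> I" using subspace_scale[OF sI y] by simp
        then show "?q \<phi> (rep ?X - rep ?Y) \<in> I"
          using diff_closed_cong[OF Ic, of "?q \<phi> (rep ?X - rep ?Y)" "?q \<phi> ?t"] slice_balanced[OF sI rI K_def \<phi> XY]
          by (simp add: lin_ext_diff)
      qed
      then have "?X = ?Y" by (rule inj_onD[OF inj]) (rule balanced_class_in_carrier)+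
      then have "?t \<in> balanced_rel K" by (simp add: tensor_class_eq_iff)
      then have "lin_ext scaleH (\<lambda>(h, g). scaleH (\<epsilon> h) g) ?t \<in> plus_ideal scaleH \<epsilon> K"
        by (rule counit_balanced[OF Kalg])
      moreover have "lin_ext scaleH (\<lambda>(h, g). scaleH (\<epsilon> h) g) ?t = y"
        by (simp add: galois_inv_eval counit_antipode slice_counit)
      ultimately show "y \<in> plus_ideal scaleH \<epsilon> K" by simp
    qed
  qed
  moreover have "inj_on ?can ?T" if closed: "I = plus_ideal scaleH \<epsilon> K"
  proof (rule inj_onI)
    fix X Y assume X: "X \<in> ?T" and Y: "Y \<in> ?T" and eq: "?can X = ?can Y"
    let ?t = "rep X - rep Y"
    have "\<forall>\<phi>. Vector_Spaces.linear scaleH (*) \<phi> \<longrightarrow> lin_ext scaleH (\<lambda>(x, y). scaleH (\<phi> x) y) (galois ?t) \<in> I"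
      using eq unfolding can_eq_iff[OF sI] galois_eval .
    then obtain t' where t': "Poly_Mapping.keys t' \<subseteq> UNIV \<times> I" "galois ?t - t' \<in> HH.trel"
      using HH.tensor_right by blast
    have "galois_inv t' \<in> balanced_rel K"
      by (rule additive_frag_in[OF additive_galois_inv tc t'(1)]) (use galois_inv_plus_ideal[OF K] closed in auto)
    moreover have "galois_inv (galois ?t) - galois_inv t' \<in> balanced_rel K"
      using trel_sub[OF galois_inv_tensor_rel[OF t'(2)]] by (simp add: additive.diff[OF additive_galois_inv])
    ultimately have "galois_inv (galois ?t) \<in> balanced_rel K" using diff_closed_cong[OF tc] by blast
    then have "?t \<in> balanced_rel K"
      using diff_closed_cong[OF tc trel_sub[OF galois_inv_galois[of ?t]]] by simp
    then have "balanced_class K (rep X) = balanced_class K (rep Y)" by (simp add: tensor_class_eq_iff)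
    then show "X = Y" unfolding class_rep[OF X] class_rep[OF Y] .
  qed
  moreover have "?can ` ?T = elems (tensor (vs scaleH) (quot_mod scaleH (quot I)))"
  proof
    have "Poly_Mapping.keys (?P s) \<subseteq> UNIV \<times> quot I" for s :: "'h \<times> 'h \<Rightarrow>\<^sub>0 int"
      by (rule order.trans[OF keys_frag_extend]) (auto simp: proj_in_quot[OF sI])
    then show "?can ` ?T \<subseteq> elems (tensor (vs scaleH) (quot_mod scaleH (quot I)))"
      unfolding elems_tensor tensor_carrier_def tensor_sums_def can_galois elems_quot_mod by auto
    show "elems (tensor (vs scaleH) (quot_mod scaleH (quot I))) \<subseteq> ?can ` ?T"
    proof
      fix Z assume "Z \<in> elems (tensor (vs scaleH) (quot_mod scaleH (quot I)))"
      then obtain z where z: "Poly_Mapping.keys z \<subseteq> UNIV \<times> quot I"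
        "Z = tensor_class UNIV (vs scaleH) (quot_mod scaleH (quot I)) z"
        unfolding elems_tensor tensor_carrier_def tensor_sums_def elems_quot_mod by auto
      let ?r = "frag_extend (\<lambda>(x, X). frag_of (x, rep X)) z"
      let ?X = "balanced_class K (galois_inv ?r)"
      have "?P (galois (rep ?X) - ?r) \<in> tensor_rel UNIV (vs scaleH) (quot_mod scaleH (quot I))"
        unfolding HH.projected_tensor_zero_iff[OF sI]
      proof (intro allI impI)
        fix \<phi> assume \<phi>: "Vector_Spaces.linear scaleH (*) \<phi>"
        let ?e = "\<lambda>t. lin_ext scaleH (\<lambda>(x, y). scaleH (\<phi> x) y) t"
        have "?e (galois (galois_inv ?r)) = ?e ?r"
          using HH.tensor_zero_iff[THEN iffD1, OF galois_galois_inv[of ?r]] \<phi> by (simp add: lin_ext_diff)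
        then show "?e (galois (rep ?X) - ?r) \<in> I"
          using slice_balanced[OF sI rI K_def \<phi> rep_tensor_class[where t = "galois_inv ?r"]]
          by (simp add: lin_ext_diff galois_eval[symmetric])
      qed
      then have "?can ?X = Z"
        unfolding z(2) can_galois tensor_class_eq_iff
        by (simp add: frag_extend_diff HH.project_lift[OF sI z(1)])
      then show "Z \<in> ?can ` ?T" using balanced_class_in_carrier by blast
    qed
  qed
  ultimately show ?thesis
    unfolding I(2) closed_iff bij_betw_def K_def[symmetric] by blast
qed

end

theorem corollary4p6p6:
  fixes scaleH :: "'k::field \<Rightarrow> 'h::{ring, monoid_mult} \<Rightarrow> 'h"
    and \<Delta> :: "'h \<Rightarrow> ('h \<times> 'h \<Rightarrow>\<^sub>0 int) set"
    and \<epsilon> :: "'h \<Rightarrow> 'k"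
    and antipode :: "'h \<Rightarrow> 'h"
    and scaleA :: "'k \<Rightarrow> 'a::{ring, monoid_mult} \<Rightarrow> 'a"
    and \<delta> :: "'a \<Rightarrow> ('a \<times> 'h \<Rightarrow>\<^sub>0 int) set"
    and B :: "'a set"
  assumes "comodule_algebra scaleH \<Delta> \<epsilon> antipode scaleA \<delta>"
    and "B = full_coinvariants scaleH scaleA \<delta>"
  shows "(\<forall>Q \<in> carrier (Quot_gen scaleH \<Delta> \<epsilon>).
            closed_Sub_Alg scaleH \<Delta> \<epsilon> scaleA \<delta> B Q \<longrightarrow>
            (\<exists>K \<in> Sub_gen scaleH \<Delta>. Q = quot (plus_ideal scaleH \<epsilon> K)))
       \<and> (\<forall>Q \<in> carrier (Quot_gen scaleH \<Delta> \<epsilon>).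
            \<not> closed_Sub_gen scaleH \<Delta> \<epsilon> Q \<longrightarrow>
            \<not> closed_Sub_Alg scaleH \<Delta> \<epsilon> scaleA \<delta> B Q)
       \<and> (\<forall>Q \<in> carrier (Quot_gen scaleH \<Delta> \<epsilon>).
            \<not> closed_Sub_gen scaleH \<Delta> \<epsilon> Q \<longleftrightarrow>
            \<not> bij_betw (can scaleH \<Delta> Q)
                (tensor_over_subalgebra (coinvariants scaleH scaleH \<Delta> Q))
                (elems (tensor (vs scaleH) (quot_mod scaleH Q))))"
proof -
  interpret comodule_algebra scaleH \<Delta> \<epsilon> antipode scaleA \<delta> by (rule assms(1))
  have closed: "closed_Sub_gen scaleH \<Delta> \<epsilon> Q"
    if "Q \<in> carrier (Quot_gen scaleH \<Delta> \<epsilon>)" "closed_Sub_Alg scaleH \<Delta> \<epsilon> scaleA \<delta> B Q" for Q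
    using closed_Sub_Alg_imp_closed_Sub_gen that assms(2) by simp
  have "\<exists>K \<in> Sub_gen scaleH \<Delta>. Q = quot (plus_ideal scaleH \<epsilon> K)"
    if Q: "Q \<in> carrier (Quot_gen scaleH \<Delta> \<epsilon>)" and cl: "closed_Sub_Alg scaleH \<Delta> \<epsilon> scaleA \<delta> B Q" for Q
  proof
    show "Q = quot (plus_ideal scaleH \<epsilon> (coinvariants scaleH scaleH \<Delta> Q))"
      using closed[OF Q cl] by (simp add: closed_Sub_gen_def)
    show "coinvariants scaleH scaleH \<Delta> Q \<in> Sub_gen scaleH \<Delta>"
      using Q coinvariants_Sub_gen by (auto simp: Quot_gen_def right_ideal_coideal_def)
  qed
  with closed closed_Sub_gen_iff_can_bij show ?thesis by blast
qed

end
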